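(* For every fixed integer $t\ge 2$, there exists a constant $D_t\ge 0$ such that the following holds. For any integer $r\ge 2$, there exist matchings $M_1,\dots,M_N$ of size $t$ in some $r$-uniform hypergraph with $tr$ vertices, where \[N\ge \left(\frac{t^t}{(t-1)^{t-1}}\right)^{r-D_t\sqrt{r}},\] such that whenever $e_1\in M_{j_1},\dots,e_t\in M_{j_t}$ are pairwise disjoint edges (for some indices $j_1,\dots,j_t\in \{1,\dots,N\}$), we must have $j_1=\dots=j_t$.
   Context: An $r$-uniform hypergraph is a hypergraph all of whose edges have exactly $r$ vertices. A matching is a collection of pairwise disjoint edges; its size is the number of edges. *)

theory Defs
  imports Complex_Main "HOL-Library.Disjoint_Sets"
begin

definition hypergraph :: "'a set \<Rightarrow> 'a set set \<Rightarrow> bool" where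
  "hypergraph V E \<longleftrightarrow> finite V \<and> (\<forall>e\<in>E. e \<subseteq> V)"

definition uniform_hypergraph :: "nat \<Rightarrow> 'a set \<Rightarrow> 'a set set \<Rightarrow> bool" where
  "uniform_hypergraph r V E \<longleftrightarrow> hypergraph V E \<and> (\<forall>e\<in>E. card e = r)"

definition is_matching :: "'a set set \<Rightarrow> 'a set set \<Rightarrow> bool" where
  "is_matching E M \<longleftrightarrow> M \<subseteq> E \<and> disjoint M"

end

theory Submission
  imports Defs "HOL-Number_Theory.Cong" "HOL-Combinatorics.Multiset_Permutations" "HOL-Library.FuncSet"
begin

text \<open>
  Matchings are colour partitions of the \<open>t r\<close> vertices into \<open>t\<close> blocks of size \<open>r\<close>. Give every vertex
  a random weight in the group of \<open>d\<close>-vectors modulo \<open>q\<close>, hash a block to its weight sum, and select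
  the partitions whose blocks \<open>1, \<dots>, t - 1\<close> all hash to the same element of a Behrend-type set \<open>S\<close>
  (integer points on a sphere, too small to wrap around modulo \<open>q\<close>). If blocks of selected partitions
  fit together to a partition, then the mean of \<open>t - 1\<close> points of \<open>S\<close> is a point of \<open>S\<close>, so by strict
  convexity they coincide and the new partition is selected as well. It therefore suffices to discard
  every selected partition that shares a block with another one.

  Two partitions sharing a block are selected together with a probability that is governed by the
  rank of the differences of their blocks, that is, by the components of the graph on the colours
  joining the two colours of each vertex. The shared block is a component of its own, so
  all components have at most \<open>t - 1\<close> elements; since \<open>k ln k / (k - 1)\<close> is increasing, a group of order
  about \<open>(t - 1) ^ (r (t - 1) / (t - 2))\<close> makes the expected number of such pairs small compared to the
  number of selected partitions. Taking \<open>d\<close> about \<open>sqrt r\<close>, the density of \<open>S\<close> and the roundings cost only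
  a factor \<open>exp (O (sqrt r))\<close>.
\<close>

section \<open>Counting solutions of linear congruences\<close>

text \<open>All fibres have the same size: an integer solution \<open>x\<close> for the right-hand
  side \<open>b2 - b1\<close>, added modulo \<open>q\<close>, injects the fibre over
  \<open>b1\<close> into the one over \<open>b2\<close>. The \<open>q ^ card J\<close> fibres
  partition the \<open>q ^ card A\<close> assignments. Because solvability is over the integers,
  \<open>q\<close> may be composite.\<close>

lemma card_linear_fibre_mod:
  fixes m :: "'j \<Rightarrow> 'a \<Rightarrow> int" and b :: "'j \<Rightarrow> int" and q :: nat
  assumes "finite A" "finite J" "q > 0"
    and surj: "\<And>y. \<exists>x. \<forall>j\<in>J. (\<Sum>a\<in>A. m j a * x a) = y j"
  shows "card {w \<in> A \<rightarrow>\<^sub>E {0..<int q}. \<forall>j\<in>J. [(\<Sum>a\<in>A. m j a * w a) = b j] (mod int q)} * q ^ card J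
    = q ^ card A"
proof -
  define P where "P = (A \<rightarrow>\<^sub>E {0..<int q})"
  define Z where "Z = (J \<rightarrow>\<^sub>E {0..<int q})"
  define fib where "fib b = {w \<in> P. \<forall>j\<in>J. [(\<Sum>a\<in>A. m j a * w a) = b j] (mod int q)}" for b
  have finP: "finite P" and finZ: "finite Z"
    unfolding P_def Z_def using assms by (auto intro!: finite_PiE)
  have le: "card (fib b1) \<le> card (fib b2)" for b1 b2
  proof -
    obtain x where x: "\<And>j. j \<in> J \<Longrightarrow> (\<Sum>a\<in>A. m j a * x a) = b2 j - b1 j"
      using surj[of "\<lambda>j. b2 j - b1 j"] by blast
    define h where "h w = (\<lambda>a\<in>A. (w a + x a) mod int q)" for w
    have "inj_on h (fib b1)"
    proof (rule inj_onI)
      fix w w' assume w: "w \<in> fib b1" "w' \<in> fib b1" and eq: "h w = h w'"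
      have P: "w \<in> P" "w' \<in> P" using w by (auto simp: fib_def)
      show "w = w'"
      proof (rule PiE_ext[OF P[unfolded P_def]])
        fix a assume a: "a \<in> A"
        have "[w a + x a = w' a + x a] (mod int q)"
          using fun_cong[OF eq, of a] a by (simp add: h_def cong_def)
        hence "[w a = w' a] (mod int q)" by (simp add: cong_add_rcancel)
        moreover have "w a \<in> {0..<int q}" "w' a \<in> {0..<int q}" using P a by (auto simp: P_def)
        ultimately show "w a = w' a" by (simp add: cong_def)
      qed
    qed
    moreover have "h ` fib b1 \<subseteq> fib b2"
    proof
      fix u assume "u \<in> h ` fib b1"
      then obtain w where w: "w \<in> fib b1" "u = h w" by auto
      have "u \<in> P" using \<open>q > 0\<close> by (auto simp: w h_def P_def)
      moreover have "[(\<Sum>a\<in>A. m j a * u a) = b2 j] (mod int q)" if "j \<in> J" for j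
      proof -
        have "[(\<Sum>a\<in>A. m j a * u a) = (\<Sum>a\<in>A. m j a * (w a + x a))] (mod int q)"
          by (rule cong_sum) (auto simp: w h_def cong_def mod_mult_right_eq)
        also have "(\<Sum>a\<in>A. m j a * (w a + x a)) = (\<Sum>a\<in>A. m j a * w a) + (b2 j - b1 j)"
          using x[OF that] by (simp add: algebra_simps sum.distrib)
        also have "[\<dots> = b1 j + (b2 j - b1 j)] (mod int q)"
          using w that by (intro cong_add) (auto simp: fib_def)
        finally show ?thesis by simp
      qed
      ultimately show "u \<in> fib b2" by (auto simp: fib_def)
    qed
    moreover have "finite (fib b2)" using finP by (auto simp: fib_def)
    ultimately show ?thesis by (metis card_inj_on_le)
  qed
  have eq: "card (fib b1) = card (fib b2)" for b1 b2 using le by (simp add: le_antisym)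
  have "P = (\<Union>z\<in>Z. fib z)"
  proof (intro equalityI subsetI)
    fix w assume w: "w \<in> P"
    define z where "z = (\<lambda>j\<in>J. (\<Sum>a\<in>A. m j a * w a) mod int q)"
    have "z \<in> Z" "w \<in> fib z" using w \<open>q > 0\<close> by (auto simp: z_def Z_def fib_def cong_def)
    thus "w \<in> (\<Union>z\<in>Z. fib z)" by auto
  qed (auto simp: fib_def)
  moreover have "card (\<Union>z\<in>Z. fib z) = (\<Sum>z\<in>Z. card (fib z))"
  proof (rule card_UN_disjoint[OF finZ])
    show "\<forall>z\<in>Z. finite (fib z)" using finP by (auto simp: fib_def)
    show "\<forall>z\<in>Z. \<forall>z'\<in>Z. z \<noteq> z' \<longrightarrow> fib z \<inter> fib z' = {}"
    proof (intro ballI impI)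
      fix z z' assume z: "z \<in> Z" "z' \<in> Z" "z \<noteq> z'"
      have False if "w \<in> fib z" "w \<in> fib z'" for w
      proof -
        have "z = z'"
        proof (rule PiE_ext[OF z(1,2)[unfolded Z_def]])
          fix j assume j: "j \<in> J"
          have "[(\<Sum>a\<in>A. m j a * w a) = z j] (mod int q)" "[(\<Sum>a\<in>A. m j a * w a) = z' j] (mod int q)"
            using that j by (auto simp: fib_def)
          hence "[z j = z' j] (mod int q)" by (metis cong_trans cong_sym)
          moreover have "z j \<in> {0..<int q}" "z' j \<in> {0..<int q}" using z j by (auto simp: Z_def)
          ultimately show "z j = z' j" by (simp add: cong_def)
        qed
        thus False using z by simp
      qed
      thus "fib z \<inter> fib z' = {}" by auto
    qed
  qed
  moreover have "(\<Sum>z\<in>Z. card (fib z)) = (\<Sum>z\<in>Z. card (fib b))"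
    by (intro sum.cong refl eq)
  ultimately have "card P = card (fib b) * card Z" by (simp add: mult.commute)
  moreover have "card P = q ^ card A" "card Z = q ^ card J"
    using assms by (simp_all add: P_def Z_def card_PiE)
  ultimately show ?thesis by (simp add: fib_def P_def)
qed

text \<open>The \<open>d\<close> coordinates do not interact, so this is the scalar count for the
  block-diagonal matrix \<open>m'\<close> whose rows are pairs of an equation and a
  coordinate.\<close>

lemma card_vector_linear_fibre_mod:
  fixes m :: "'j \<Rightarrow> 'a \<Rightarrow> int" and b :: "'j \<Rightarrow> nat \<Rightarrow> int" and q :: nat
  assumes "finite A" "finite J" "q > 0"
    and surj: "\<And>y. \<exists>x. \<forall>j\<in>J. (\<Sum>a\<in>A. m j a * x a) = y j"
  shows "card {w \<in> (A \<times> {..<d}) \<rightarrow>\<^sub>E {0..<int q}.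
      \<forall>j\<in>J. \<forall>c<d. [(\<Sum>a\<in>A. m j a * w (a, c)) = b j c] (mod int q)} * (q ^ d) ^ card J
    = (q ^ d) ^ card A"
proof -
  define m' where "m' = (\<lambda>(j, c :: nat) (a, c'). if c = c' then m j a else 0 :: int)"
  have sum: "(\<Sum>p\<in>A \<times> {..<d}. m' (j, c) p * w p) = (\<Sum>a\<in>A. m j a * w (a, c))" if "c < d" for j c w
  proof -
    have "(\<Sum>p\<in>A \<times> {..<d}. m' (j, c) p * w p) = (\<Sum>a\<in>A. \<Sum>c'<d. m' (j, c) (a, c') * w (a, c'))"
      by (simp add: sum.cartesian_product)
    also have "\<dots> = (\<Sum>a\<in>A. \<Sum>c'<d. if c = c' then m j a * w (a, c) else 0)"
      by (intro sum.cong) (auto simp: m'_def)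
    also have "\<dots> = (\<Sum>a\<in>A. m j a * w (a, c))" using that by simp
    finally show ?thesis .
  qed
  have surj': "\<exists>x. \<forall>jc\<in>J \<times> {..<d}. (\<Sum>p\<in>A \<times> {..<d}. m' jc p * x p) = y jc" for y
  proof -
    have "\<exists>x. \<forall>j\<in>J. (\<Sum>a\<in>A. m j a * x a) = y (j, c)" for c
      using surj[of "\<lambda>j. y (j, c)"] .
    then obtain X where X: "\<And>c j. j \<in> J \<Longrightarrow> (\<Sum>a\<in>A. m j a * X c a) = y (j, c)" by metis
    show ?thesis
      by (rule exI[of _ "\<lambda>(a, c). X c a"]) (auto simp: sum X)
  qed
  have "{w \<in> (A \<times> {..<d}) \<rightarrow>\<^sub>E {0..<int q}.
      \<forall>j\<in>J. \<forall>c<d. [(\<Sum>a\<in>A. m j a * w (a, c)) = b j c] (mod int q)} =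
    {w \<in> (A \<times> {..<d}) \<rightarrow>\<^sub>E {0..<int q}.
      \<forall>jc\<in>J \<times> {..<d}. [(\<Sum>p\<in>A \<times> {..<d}. m' jc p * w p) = (case jc of (j, c) \<Rightarrow> b j c)] (mod int q)}"
    by (auto simp: sum)
  thus ?thesis
    using card_linear_fibre_mod[of "A \<times> {..<d}" "J \<times> {..<d}" q m' "\<lambda>(j, c). b j c"] assms surj'
    by (simp add: card_cartesian_product power_mult[symmetric] mult.commute)
qed

section \<open>Monotonicity and factorial estimates\<close>

text \<open>Cleared of denominators, the step from \<open>m\<close> to \<open>m + 1\<close> reads ln
  (m + 1) \<le> m^2 (ln (m + 1) - ln m), which is Bernoulli's inequality (1 + 1/m)^(m^2) \<ge> 1 + m
  after taking logarithms.\<close>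

lemma power_self_exponent_mono:
  fixes k m :: nat
  assumes "2 \<le> k" "k \<le> m"
  shows "real k * ln k / (real k - 1) \<le> real m * ln m / (real m - 1)"
  using assms(2,1)
proof (induction m rule: dec_induct)
  case (step m)
  hence m: "m \<ge> 2" by simp
  have "1 + real (m * m) * (1 / real m) \<le> (1 + 1 / real m) ^ (m * m)"
    by (rule Bernoulli_inequality) (use m in \<open>simp add: order_trans[of _ 0]\<close>)
  hence "real m + 1 \<le> ((real m + 1) / real m) ^ (m * m)" using m by (simp add: field_simps)
  hence "ln (real m + 1) \<le> ln (((real m + 1) / real m) ^ (m * m))" using m by (subst ln_le_cancel_iff) auto
  also have "\<dots> = real m * real m * (ln (real m + 1) - ln m)"
    using m by (simp add: ln_realpow ln_div)
  finally have "real m * ln m / (real m - 1) \<le> real (Suc m) * ln (Suc m) / (real (Suc m) - 1)"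
    using m by (simp add: field_simps)
  with step show ?case by linarith
qed simp


text \<open>Together with \<open>exp_fact_le\<close> a two-sided Stirling estimate; the two
  inductions rest on (1 + 1/n)^n \<le> e \<le> (1 + 1/n)^(n + 1).\<close>

lemma power_self_le_exp_fact: "real n ^ n \<le> exp (real n) * fact n"
proof (induction n)
  case (Suc n)
  show ?case
  proof (cases "n = 0")
    case False
    have "(real n + 1) ^ n = (1 + 1 / real n) ^ n * real n ^ n"
      using False by (simp add: power_mult_distrib[symmetric] field_simps)
    also have "(1 + 1 / real n) ^ n \<le> exp (1 / real n) ^ n"
      by (intro power_mono) auto
    also have "exp (1 / real n) ^ n = exp 1" using False by (simp add: exp_of_nat_mult[symmetric])
    finally have "(real n + 1) ^ n \<le> exp 1 * real n ^ n"
      by (simp add: mult_right_mono)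
    also have "\<dots> \<le> exp 1 * (exp (real n) * fact n)"
      using Suc.IH by (intro mult_left_mono) auto
    finally have "(real n + 1) * (real n + 1) ^ n \<le> (real n + 1) * (exp 1 * (exp (real n) * fact n))"
      by (intro mult_left_mono) auto
    thus ?thesis by (simp add: exp_add algebra_simps)
  qed simp
qed simp

lemma exp_fact_le:
  assumes "n \<ge> 1"
  shows "exp (real n) * fact n \<le> exp 1 * real n * real n ^ n"
  using assms
proof (induction n rule: dec_induct)
  case (step n)
  have "real n / (real n + 1) \<le> exp (- 1 / (real n + 1))"
    using exp_ge_add_one_self[of "- 1 / (real n + 1)"] by (simp add: field_simps)
  hence "(real n / (real n + 1)) ^ (n + 1) \<le> exp (- 1 / (real n + 1)) ^ (n + 1)"
    by (intro power_mono) auto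
  also have "\<dots> = exp (- 1)"
    by (simp only: exp_of_nat_mult[symmetric]) simp
  finally have *: "exp 1 * real n ^ (n + 1) \<le> (real n + 1) ^ (n + 1)"
    by (simp only: power_divide exp_minus) (simp add: divide_le_eq le_divide_eq inverse_eq_divide mult.commute)
  have "exp (real (Suc n)) * fact (Suc n) = exp 1 * (real n + 1) * (exp (real n) * fact n)"
    by (simp add: exp_add algebra_simps)
  also have "\<dots> \<le> exp 1 * (real n + 1) * (exp 1 * real n * real n ^ n)"
    by (intro mult_left_mono step.IH) auto
  also have "\<dots> = exp 1 * (real n + 1) * (exp 1 * real n ^ (n + 1))" by simp
  also have "\<dots> \<le> exp 1 * (real n + 1) * (real n + 1) ^ (n + 1)"
    by (intro mult_left_mono *) auto
  finally show ?case by (simp add: add.commute)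
qed simp

text \<open>The balanced multinomial coefficient falls short of \<open>t ^ (t * n)\<close> by a
  factor polynomial in \<open>n\<close> only: the exponentials in the upper estimate for
  \<open>fact n\<close> and the lower one for \<open>fact (t * n)\<close> cancel.\<close>

lemma multinomial_lower:
  assumes "n \<ge> 1"
  shows "real t ^ (t * n) * fact n ^ t \<le> fact (t * n) * (exp 1 * real n) ^ t"
proof -
  have "(exp (real n) * fact n) ^ t \<le> (exp 1 * real n * real n ^ n) ^ t"
    by (intro power_mono exp_fact_le assms) auto
  hence "real t ^ (t * n) * (exp (real n) * fact n) ^ t \<le> real t ^ (t * n) * (exp 1 * real n * real n ^ n) ^ t"
    by (intro mult_left_mono) auto
  also have "\<dots> = (exp 1 * real n) ^ t * real (t * n) ^ (t * n)"
    by (simp add: power_mult_distrib power_mult[symmetric] mult.commute)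
  also have "\<dots> \<le> (exp 1 * real n) ^ t * (exp (real (t * n)) * fact (t * n))"
    by (intro mult_left_mono power_self_le_exp_fact) auto
  also have "exp (real (t * n)) = exp (real n) ^ t" by (simp add: exp_of_nat_mult[symmetric])
  finally have "exp (real n) ^ t * (real t ^ (t * n) * fact n ^ t)
      \<le> exp (real n) ^ t * (fact (t * n) * (exp 1 * real n) ^ t)"
    by (simp add: power_mult_distrib algebra_simps)
  thus ?thesis by simp
qed

section \<open>Flows on a multigraph and its connected components\<close>

text \<open>
  The elements of \<open>V\<close> are read as edges \<open>f v \<rightarrow> g v\<close> of a multigraph, and \<open>excess f g j\<close> is the
  divergence at \<open>j\<close>. The divergences at all but one vertex of each connected component are
  independent, even over the integers, so the number of \<open>nonmin\<close> vertices is their rank.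
\<close>

definition flow_rel :: "'a set \<Rightarrow> ('a \<Rightarrow> nat) \<Rightarrow> ('a \<Rightarrow> nat) \<Rightarrow> (nat \<times> nat) set" where
  "flow_rel V f g = (let E = (\<lambda>v. (f v, g v)) ` V in (E \<union> E\<inverse>)\<^sup>*)"

definition nonmin :: "nat set \<Rightarrow> (nat \<times> nat) set \<Rightarrow> nat set" where
  "nonmin A R = {i \<in> A. \<exists>j<i. (j, i) \<in> R}"

definition excess :: "('a \<Rightarrow> nat) \<Rightarrow> ('a \<Rightarrow> nat) \<Rightarrow> nat \<Rightarrow> 'a \<Rightarrow> int" where
  "excess f g j v = of_bool (f v = j) - of_bool (g v = j)"

lemma equiv_flow_rel:
  assumes "f \<in> V \<rightarrow> A" "g \<in> V \<rightarrow> A"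
  shows "equiv A (flow_rel V f g \<inter> A \<times> A)"
proof (rule equivI)
  show "sym (flow_rel V f g \<inter> A \<times> A)"
    using sym_rtrancl[OF sym_Un_converse, of "(\<lambda>v. (f v, g v)) ` V"]
    by (auto simp: flow_rel_def Let_def sym_def)
  show "trans (flow_rel V f g \<inter> A \<times> A)"
    by (auto simp: flow_rel_def Let_def trans_def)
qed (auto simp: flow_rel_def Let_def refl_on_def)

text \<open>Send one unit along a path from \<open>i\<close> to \<open>k\<close>; an edge traversed
  against its direction receives the coefficient -1.\<close>

lemma flow_between:
  assumes "finite V" "(i, k) \<in> flow_rel V f g"
  shows "\<exists>x. \<forall>j. (\<Sum>v\<in>V. excess f g j v * x v) = of_bool (j = i) - of_bool (j = k)"
proof -
  have "(i, k) \<in> ((\<lambda>v. (f v, g v)) ` V \<union> ((\<lambda>v. (f v, g v)) ` V)\<inverse>)\<^sup>*"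
    using assms(2) by (simp add: flow_rel_def Let_def)
  thus ?thesis
  proof (induction rule: rtrancl_induct)
    case base
    show ?case by (rule exI[of _ "\<lambda>_. 0"]) simp
  next
    case (step k l)
    then obtain x where x: "\<And>j. (\<Sum>v\<in>V. excess f g j v * x v) = of_bool (j = i) - of_bool (j = k)"
      by blast
    from step(2) obtain v \<epsilon> where v: "v \<in> V"
      and \<epsilon>: "\<And>j. excess f g j v * \<epsilon> = of_bool (j = k) - of_bool (j = l)"
    proof -
      assume *: "\<And>v \<epsilon>. v \<in> V \<Longrightarrow> (\<And>j. excess f g j v * \<epsilon> = of_bool (j = k) - of_bool (j = l)) \<Longrightarrow> thesis"
      consider v where "v \<in> V" "f v = k" "g v = l" | v where "v \<in> V" "f v = l" "g v = k"
        using step(2) by auto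
      thus thesis
        by cases (use *[where \<epsilon> = 1] *[where \<epsilon> = "-1"] in \<open>fastforce simp: excess_def\<close>)+
    qed
    have "(\<Sum>u\<in>V. excess f g j u * (x u + (if u = v then \<epsilon> else 0))) = of_bool (j = i) - of_bool (j = l)" for j
    proof -
      have "(\<Sum>u\<in>V. excess f g j u * (x u + (if u = v then \<epsilon> else 0))) =
        (\<Sum>u\<in>V. excess f g j u * x u) + (\<Sum>u\<in>V. if u = v then excess f g j v * \<epsilon> else 0)"
        by (subst sum.distrib[symmetric]) (auto intro!: sum.cong simp: algebra_simps)
      also have "\<dots> = of_bool (j = i) - of_bool (j = l)"
        using x \<epsilon> v \<open>finite V\<close> by simp
      finally show ?thesis .
    qed
    thus ?case by (intro exI[of _ "\<lambda>u. x u + (if u = v then \<epsilon> else 0)"] allI)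
  qed
qed

text \<open>A unit sent from \<open>i\<close> to the least element of its class realises the
  \<open>i\<close>-th unit vector, since the divergence at that least element is not prescribed.
  Integer combinations of these flows give every \<open>y\<close>.\<close>

lemma excess_surj:
  assumes V: "finite V" and A: "finite A" "f \<in> V \<rightarrow> A" "g \<in> V \<rightarrow> A"
  shows "\<exists>x. \<forall>j\<in>nonmin A (flow_rel V f g \<inter> A \<times> A). (\<Sum>v\<in>V. excess f g j v * x v) = y j"
proof -
  define R where "R = flow_rel V f g \<inter> A \<times> A"
  define T where "T = nonmin A R"
  have eq: "equiv A R" unfolding R_def by (rule equiv_flow_rel[OF A(2,3)])
  have "\<exists>x. \<forall>j\<in>T. (\<Sum>v\<in>V. excess f g j v * x v) = of_bool (j = i)" if "i \<in> T" for i
  proof -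
    define k where "k = (LEAST k. (k, i) \<in> R)"
    have ki: "(k, i) \<in> R" 
      unfolding k_def by (rule LeastI_ex) (use that in \<open>auto simp: T_def nonmin_def\<close>)
    have "k \<notin> T"
    proof
      assume "k \<in> T"
      then obtain j where "j < k" "(j, k) \<in> R" by (auto simp: T_def nonmin_def)
      hence "(j, i) \<in> R" using ki eq by (meson equivE transE)
      thus False using \<open>j < k\<close> not_less_Least k_def by blast
    qed
    moreover have "(i, k) \<in> R" using ki eq by (meson equivE symE)
    ultimately have k: "k \<notin> T" "(i, k) \<in> flow_rel V f g" by (auto simp: R_def)
    obtain x where "\<And>j. (\<Sum>v\<in>V. excess f g j v * x v) = of_bool (j = i) - of_bool (j = k)"
      using flow_between[OF V k(2)] by blast
    with k(1) show ?thesis by (intro exI[of _ x] ballI) auto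
  qed
  then obtain X where X: "\<And>i j. i \<in> T \<Longrightarrow> j \<in> T \<Longrightarrow> (\<Sum>v\<in>V. excess f g j v * X i v) = of_bool (j = i)"
    by metis
  have fT: "finite T" using A by (simp add: T_def nonmin_def)
  have "(\<Sum>v\<in>V. excess f g j v * (\<Sum>i\<in>T. y i * X i v)) = y j" if "j \<in> T" for j
  proof -
    have "(\<Sum>v\<in>V. excess f g j v * (\<Sum>i\<in>T. y i * X i v)) =
      (\<Sum>i\<in>T. y i * (\<Sum>v\<in>V. excess f g j v * X i v))"
      by (simp add: sum_distrib_left sum.swap[of _ V] algebra_simps)
    also have "\<dots> = (\<Sum>i\<in>T. if j = i then y i else 0)"
      using X that by (intro sum.cong) auto
    also have "\<dots> = y j" using that fT by simp
    finally show ?thesis .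
  qed
  hence "\<exists>x. \<forall>j\<in>T. (\<Sum>v\<in>V. excess f g j v * x v) = y j" by (intro exI[of _ "\<lambda>v. \<Sum>i\<in>T. y i * X i v"] ballI)
  thus ?thesis unfolding T_def R_def .
qed

text \<open>A class \<open>C\<close> contributes \<open>card C ^ card C\<close> to the product and
  \<open>card C - 1\<close> elements to \<open>nonmin A R\<close>, so the hypothesis can be applied
  class by class.\<close>

lemma prod_class_card_le:
  fixes R :: "(nat \<times> nat) set" and \<alpha> :: real
  assumes A: "finite A" and eq: "equiv A R" and "\<alpha> \<ge> 0"
    and le: "\<And>k. k \<in> (\<lambda>i. card (R `` {i})) ` A \<Longrightarrow> real k ^ k \<le> \<alpha> ^ (k - 1)"
  shows "(\<Prod>i\<in>A. real (card (R `` {i}))) \<le> \<alpha> ^ card (nonmin A R)"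
proof -
  note fin = finite_equiv_class[OF A equiv_type[OF eq]]
  have disj: "\<forall>C\<in>A // R. \<forall>D\<in>A // R. C \<noteq> D \<longrightarrow> C \<inter> D = {}"
    using quotient_disj[OF eq] by blast
  have memT: "i \<in> nonmin A R \<longleftrightarrow> i \<noteq> Min (R `` {i})" if "i \<in> A" for i
  proof -
    have f: "finite (R `` {i})" using fin that by (simp add: quotientI)
    have i: "i \<in> R `` {i}" by (rule equiv_class_self[OF eq that])
    have "(j, i) \<in> R \<longleftrightarrow> j \<in> R `` {i}" for j using eq by (auto elim!: equivE dest: symD)
    hence "(\<exists>j<i. (j, i) \<in> R) \<longleftrightarrow> (\<exists>j\<in>R `` {i}. j < i)" by blast
    also have "\<dots> \<longleftrightarrow> Min (R `` {i}) < i" using f i Min_less_iff[of "R `` {i}" i] by blast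
    also have "\<dots> \<longleftrightarrow> i \<noteq> Min (R `` {i})" using Min_le[OF f i] by linarith
    finally show ?thesis using that by (simp add: nonmin_def)
  qed
  have T: "nonmin A R = (\<Union>C\<in>A // R. C - {Min C})"
  proof (intro equalityI subsetI)
    fix i assume i: "i \<in> nonmin A R"
    hence "i \<in> A" by (simp add: nonmin_def)
    thus "i \<in> (\<Union>C\<in>A // R. C - {Min C})"
      using memT[of i] i quotientI[of i A R] equiv_class_self[OF eq, of i] by blast
  next
    fix i assume "i \<in> (\<Union>C\<in>A // R. C - {Min C})"
    then obtain C where C: "C \<in> A // R" "i \<in> C" "i \<noteq> Min C" by blast
    have "i \<in> A" using C eq by (meson in_quotient_imp_subset subsetD)
    moreover have "R `` {i} = C" using C eq by (auto elim!: quotientE dest: equiv_class_eq)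
    ultimately show "i \<in> nonmin A R" using memT C by blast
  qed
  have "(\<Prod>i\<in>A. real (card (R `` {i}))) = (\<Prod>C\<in>A // R. \<Prod>i\<in>C. real (card (R `` {i})))"
  proof -
    have "\<forall>C\<in>A // R. finite C" using fin by blast
    from prod.Union_disjoint[OF this disj, of "\<lambda>i. real (card (R `` {i}))"]
    show ?thesis by (simp only: Union_quotient[OF eq] o_def)
  qed
  also have "\<dots> = (\<Prod>C\<in>A // R. \<Prod>i\<in>C. real (card C))"
  proof (intro prod.cong refl)
    fix C i assume C: "C \<in> A // R" "i \<in> C"
    hence "R `` {i} = C" using eq by (auto elim!: quotientE dest: equiv_class_eq)
    thus "real (card (R `` {i})) = real (card C)" by simp
  qed
  also have "\<dots> = (\<Prod>C\<in>A // R. real (card C) ^ card C)" by simp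
  also have "\<dots> \<le> (\<Prod>C\<in>A // R. \<alpha> ^ (card C - 1))"
  proof (intro prod_mono conjI)
    fix C assume "C \<in> A // R"
    thus "real (card C) ^ card C \<le> \<alpha> ^ (card C - 1)"
      by (intro le) (auto elim!: quotientE)
  qed simp
  also have "\<dots> = \<alpha> ^ (\<Sum>C\<in>A // R. card (C - {Min C}))"
  proof -
    have "card (C - {Min C}) = card C - 1" if "C \<in> A // R" for C
      using that fin in_quotient_imp_non_empty[OF eq] by simp
    thus ?thesis by (simp add: power_sum)
  qed
  also have "(\<Sum>C\<in>A // R. card (C - {Min C})) = card (nonmin A R)"
  proof -
    have "(C - {Min C}) \<inter> (D - {Min D}) = {}" if "C \<in> A // R" "D \<in> A // R" "C \<noteq> D" for C D
      using disj that by blast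
    hence "\<forall>C\<in>A // R. \<forall>D\<in>A // R. C \<noteq> D \<longrightarrow> (C - {Min C}) \<inter> (D - {Min D}) = {}" by blast
    moreover have "\<forall>C\<in>A // R. finite (C - {Min C})" using fin by blast
    ultimately show ?thesis
      unfolding T by (subst card_UN_disjoint[OF finite_quotient[OF A equiv_type[OF eq]]]) simp_all
  qed
  finally show ?thesis .
qed

section \<open>The growth constant\<close>

text \<open>
  The \<open>r\<close>-th power of this number is, up to lower order, the size of the group of hash values; at
  \<open>t = 2\<close> the exponent is \<open>1 / 0 = 0\<close> and the value \<open>1\<close> is still the right one.
\<close>

definition growth :: "nat \<Rightarrow> real" where
  "growth t = (real t - 1) powr ((real t - 1) / (real t - 2))"

lemma growth_ge_1: "t \<ge> 2 \<Longrightarrow> growth t \<ge> 1"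
  unfolding growth_def by (cases "t = 2") (auto intro!: ge_one_powr_ge_zero)

text \<open>This identity turns the cost of the hash group into the denominator
  \<open>(t - 1) ^ (t - 1)\<close> of the base in the theorem.\<close>

lemma growth_power: "t \<ge> 2 \<Longrightarrow> growth t ^ (t - 2) = (real t - 1) ^ (t - 1)"
proof -
  assume t: "t \<ge> 2"
  show ?thesis
  proof (cases "t = 2")
    case False
    hence "growth t ^ (t - 2) = (real t - 1) powr ((real t - 1) / (real t - 2) * real (t - 2))"
      using t by (simp add: growth_def powr_powr flip: powr_realpow)
    also have "(real t - 1) / (real t - 2) * real (t - 2) = real (t - 1)"
      using t False by (simp add: of_nat_diff)
    also have "(real t - 1) powr \<dots> = (real t - 1) ^ (t - 1)"
      using t by (subst powr_realpow) auto
    finally show ?thesis .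
  qed simp
qed

text \<open>By monotonicity of k ln k / (k - 1) the extreme case is k = t - 1, from which
  \<open>growth\<close> is read off. This supplies the hypothesis of
  \<open>prod_class_card_le\<close>.\<close>

lemma power_self_le_growth:
  assumes "1 \<le> k" "k \<le> t - 1" "t \<ge> 2"
  shows "real k ^ k \<le> growth t ^ (k - 1)"
proof (cases "k = 1")
  case False
  hence k: "2 \<le> k" "3 \<le> t" using assms by auto
  have "real k * ln k / (real k - 1) \<le> real (t - 1) * ln (real (t - 1)) / (real (t - 1) - 1)"
    by (rule power_self_exponent_mono) (use k assms in auto)
  also have "\<dots> = ln (growth t)"
    using k by (simp add: growth_def of_nat_diff ln_powr)
  finally have "real k * ln k \<le> real (k - 1) * ln (growth t)"
    using k by (simp add: field_simps of_nat_diff)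
  hence "ln (real k ^ k) \<le> ln (growth t ^ (k - 1))"
    using k growth_ge_1[OF assms(3)] by (simp add: ln_realpow)
  thus ?thesis using k growth_ge_1[OF assms(3)] by (subst (asm) ln_le_cancel_iff) auto
qed simp

section \<open>Integer points on spheres\<close>

text \<open>Pigeonhole: the \<open>L ^ d\<close> points of the box have at most
  \<open>d * L\<^sup>2\<close> different squared norms.\<close>

lemma exists_large_sphere:
  fixes d L :: nat
  assumes "d \<ge> 1" "L \<ge> 1"
  obtains S :: "(nat \<Rightarrow> int) set" and \<rho> where
    "S \<subseteq> {..<d} \<rightarrow>\<^sub>E {0..<int L}" "\<And>s. s \<in> S \<Longrightarrow> (\<Sum>c<d. (s c)\<^sup>2) = \<rho>"
    "L ^ d \<le> card S * (d * L\<^sup>2)"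
proof -
  define P where "P = ({..<d} \<rightarrow>\<^sub>E {0..<int L})"
  define Z where "Z = {0..<int (d * L\<^sup>2)}"
  define sph where "sph \<rho> = {s \<in> P. (\<Sum>c<d. (s c)\<^sup>2) = \<rho>}" for \<rho>
  have finP: "finite P" unfolding P_def by (auto intro!: finite_PiE)
  have "(\<Sum>c<d. (s c)\<^sup>2) \<in> Z" if "s \<in> P" for s
  proof -
    have s: "0 \<le> s c \<and> s c < int L" if "c < d" for c
      using PiE_mem[OF \<open>s \<in> P\<close>[unfolded P_def], of c] that by simp
    have "(\<Sum>c<d. (s c)\<^sup>2) < (\<Sum>c<d. (int L)\<^sup>2)"
      using assms s by (intro sum_strict_mono power_strict_mono) (auto simp: lessThan_empty_iff)
    moreover have "0 \<le> (\<Sum>c<d. (s c)\<^sup>2)" by (intro sum_nonneg) simp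
    ultimately show ?thesis by (simp add: Z_def)
  qed
  hence "P = (\<Union>\<rho>\<in>Z. sph \<rho>)" by (auto simp: sph_def)
  hence "card P \<le> (\<Sum>\<rho>\<in>Z. card (sph \<rho>))" using card_UN_le[of Z sph] by (simp add: Z_def)
  moreover have "card P = L ^ d" by (simp add: P_def card_PiE)
  ultimately have le: "L ^ d \<le> (\<Sum>\<rho>\<in>Z. card (sph \<rho>))" by simp
  have "\<exists>\<rho>\<in>Z. L ^ d \<le> card (sph \<rho>) * (d * L\<^sup>2)"
  proof (rule ccontr)
    assume "\<not> ?thesis"
    hence "(\<Sum>\<rho>\<in>Z. card (sph \<rho>) * (d * L\<^sup>2)) < (\<Sum>\<rho>\<in>Z. L ^ d)"
      using assms by (intro sum_strict_mono) (auto simp: Z_def not_le)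
    also have "\<dots> = L ^ d * (d * L\<^sup>2)" by (simp add: Z_def del: of_nat_mult)
    finally have "(\<Sum>\<rho>\<in>Z. card (sph \<rho>)) * (d * L\<^sup>2) < L ^ d * (d * L\<^sup>2)"
      by (simp only: sum_distrib_right)
    thus False using mult_le_mono1[OF le, of "d * L\<^sup>2"] by linarith
  qed
  then obtain \<rho> where \<rho>: "L ^ d \<le> card (sph \<rho>) * (d * L\<^sup>2)" by blast
  have "sph \<rho> \<subseteq> P" by (auto simp: sph_def)
  from that[OF this[unfolded P_def] _ \<rho>] show thesis by (simp add: sph_def)
qed

text \<open>Strict convexity: expanding the sum over \<open>i\<close> of the squared distances from
  \<open>s i\<close> to \<open>s0\<close> gives card I (\<rho> + \<rho> - 2 \<rho>) = 0.\<close>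

lemma sphere_mean_eq:
  fixes s :: "'i \<Rightarrow> nat \<Rightarrow> int"
  assumes I: "finite I" "i \<in> I" "c < d"
    and \<rho>: "\<And>i. i \<in> I \<Longrightarrow> (\<Sum>c<d. (s i c)\<^sup>2) = \<rho>" "(\<Sum>c<d. (s0 c)\<^sup>2) = \<rho>"
    and mean: "\<And>c. c < d \<Longrightarrow> (\<Sum>i\<in>I. s i c) = int (card I) * s0 c"
  shows "s i c = s0 c"
proof -
  have "(\<Sum>i\<in>I. \<Sum>c<d. (s i c - s0 c)\<^sup>2) =
    (\<Sum>i\<in>I. \<Sum>c<d. (s i c)\<^sup>2) + (\<Sum>i\<in>I. \<Sum>c<d. (s0 c)\<^sup>2) - 2 * (\<Sum>i\<in>I. \<Sum>c<d. s0 c * s i c)"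
    by (simp add: power2_diff sum.distrib sum_subtractf sum_distrib_left mult_ac)
  also have "(\<Sum>i\<in>I. \<Sum>c<d. s0 c * s i c) = (\<Sum>c<d. s0 c * (\<Sum>i\<in>I. s i c))"
    by (subst sum.swap) (simp add: sum_distrib_left)
  also have "\<dots> = (\<Sum>c<d. int (card I) * (s0 c)\<^sup>2)"
    by (intro sum.cong) (auto simp: mean power2_eq_square)
  also have "\<dots> = int (card I) * \<rho>" by (simp add: \<rho>(2) flip: sum_distrib_left)
  finally have "(\<Sum>i\<in>I. \<Sum>c<d. (s i c - s0 c)\<^sup>2) = 0" using \<rho> by simp
  hence "(\<Sum>c<d. (s i c - s0 c)\<^sup>2) = 0"
    using I by (subst (asm) sum_nonneg_eq_0_iff) (auto intro: sum_nonneg)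
  thus ?thesis using I by (subst (asm) sum_nonneg_eq_0_iff) auto
qed

section \<open>Counting balanced colourings\<close>

text \<open>
  Fixing the colours of the vertices \<open>0, \<dots>, t - 1\<close> costs only a polynomial factor in \<open>r\<close>, and makes the
  colour of a block readable from the block itself.
\<close>

definition balanced_colourings :: "nat \<Rightarrow> nat \<Rightarrow> (nat \<Rightarrow> nat) set" where
  "balanced_colourings t r = {f \<in> {..<t * r} \<rightarrow>\<^sub>E {..<t}.
     (\<forall>i<t. f i = i) \<and> (\<forall>i<t. card {v \<in> {..<t * r}. f v = i} = r)}"

lemma finite_balanced_colourings [simp]: "finite (balanced_colourings t r)"
  unfolding balanced_colourings_def by (rule finite_subset[OF _ finite_PiE[of "{..<t * r}" "\<lambda>_. {..<t}"]]) auto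

text \<open>After the \<open>t\<close> fixed vertices the remaining \<open>t * n\<close> carry an
  arbitrary word with each colour \<open>n\<close> times; these words are the permutations of the
  multiset \<open>A\<close>. The fixed vertex raises the block size to \<open>Suc n\<close>.\<close>

lemma card_balanced_colourings_lower:
  assumes "n \<ge> 1"
  shows "fact (t * n) \<le> card (balanced_colourings t (Suc n)) * fact n ^ t"
proof -
  define A where "A = (\<Sum>i<t. replicate_mset n i)"
  have count: "count A i = (if i < t then n else 0)" for i
    by (simp add: A_def count_sum)
  have set: "set_mset A = {..<t}"
    using assms by (auto simp: set_mset_def count split: if_splits)
  have size: "size A = t * n" by (simp add: A_def size_multiset_sum)
  define h where "h xs = (\<lambda>v\<in>{..<t * Suc n}. if v < t then v else xs ! (v - t))" for xs
  have len: "length xs = t * n" "mset xs = A" if "xs \<in> permutations_of_multiset A" for xs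
    using that size size_mset[of xs] by (auto simp: permutations_of_multiset_def)
  have "inj_on h (permutations_of_multiset A)"
  proof (rule inj_onI)
    fix xs ys assume *: "xs \<in> permutations_of_multiset A" "ys \<in> permutations_of_multiset A" "h xs = h ys"
    show "xs = ys"
    proof (rule nth_equalityI)
      fix k assume "k < length xs"
      thus "xs ! k = ys ! k"
        using fun_cong[OF *(3), of "t + k"] len[OF *(1)] by (simp add: h_def)
    qed (use len * in simp)
  qed
  moreover have "h ` permutations_of_multiset A \<subseteq> balanced_colourings t (Suc n)"
  proof
    fix f assume "f \<in> h ` permutations_of_multiset A"
    then obtain xs where xs: "xs \<in> permutations_of_multiset A" and f: "f = h xs" by blast
    note l = len[OF xs]
    have mem: "xs ! k < t" if "k < t * n" for k
      using l set nth_mem[of k xs] that by (metis lessThan_iff set_mset_mset)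
    have fibre: "card {v \<in> {..<t * Suc n}. f v = i} = Suc n" if "i < t" for i
    proof -
      have "{v \<in> {..<t * Suc n}. f v = i} = insert i ((+) t ` {k. k < length xs \<and> xs ! k = i})"
      proof (intro equalityI subsetI)
        fix v assume v: "v \<in> {v \<in> {..<t * Suc n}. f v = i}"
        show "v \<in> insert i ((+) t ` {k. k < length xs \<and> xs ! k = i})"
        proof (cases "v < t")
          case False
          hence "v = t + (v - t)" "v - t < length xs" "xs ! (v - t) = i"
            using v l by (auto simp: f h_def)
          thus ?thesis by blast
        qed (use v in \<open>auto simp: f h_def\<close>)
      qed (use that l in \<open>auto simp: f h_def\<close>)
      also have "card \<dots> = Suc (card {k. k < length xs \<and> xs ! k = i})"
        using that by (subst card_insert_disjoint) (auto simp: card_image)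
      also have "card {k. k < length xs \<and> xs ! k = i} = count (mset xs) i"
        by (simp add: count_mset count_list_eq_length_filter length_filter_conv_card eq_commute)
      also have "\<dots> = n" using l count that by simp
      finally show ?thesis .
    qed
    show "f \<in> balanced_colourings t (Suc n)"
      unfolding balanced_colourings_def using fibre mem by (auto simp: f h_def)
  qed
  ultimately have "card (permutations_of_multiset A) \<le> card (balanced_colourings t (Suc n))"
    by (metis card_inj_on_le finite_balanced_colourings)
  moreover have "fact (t * n) = card (permutations_of_multiset A) * fact n ^ t"
    using card_permutations_of_multiset_aux[of A] by (simp add: set count size)
  ultimately show ?thesis by simp
qed

section \<open>Hashing colourings by random weights\<close>

locale colour_hash =
  fixes t r d L :: nat and S :: "(nat \<Rightarrow> int) set" and \<rho> :: int
  assumes t: "t \<ge> 2" and r: "r \<ge> 1" and L: "L \<ge> 1"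
    and S: "S \<subseteq> {..<d} \<rightarrow>\<^sub>E {0..<int L}"
    and sphere: "\<And>s. s \<in> S \<Longrightarrow> (\<Sum>c<d. (s c)\<^sup>2) = \<rho>"
begin

text \<open>With this modulus, sums of at most \<open>t - 1\<close> coordinates of points of
  \<open>S\<close> stay below \<open>q\<close>, so congruences between them are equalities.\<close>

definition "q = t * L"
definition "V = {..<t * r}"
definition "F = balanced_colourings t r"
definition "block f i = {v \<in> V. f v = (i :: nat)}"
definition "W = (V \<times> {..<d}) \<rightarrow>\<^sub>E {0..<int q}"

text \<open>
  Block \<open>0\<close> carries no condition of its own: its hash is determined by the others, see
  \<open>hashes_complement\<close>.
\<close>

definition hashes :: "(nat \<times> nat \<Rightarrow> int) \<Rightarrow> (nat \<Rightarrow> nat) \<Rightarrow> (nat \<Rightarrow> int) \<Rightarrow> bool" where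
  "hashes w f s \<longleftrightarrow>
     (\<forall>i\<in>{1..<t}. \<forall>c<d. [(\<Sum>v\<in>block f i. w (v, c)) = s c] (mod int q))"

definition "selected w = {f \<in> F. \<exists>s\<in>S. hashes w f s}"

text \<open>Comparing blocks of equal colour suffices: for a colouring in \<open>F\<close>, the only
  vertex below \<open>t\<close> in block \<open>i\<close> is \<open>i\<close>, so a common block has
  the same colour in both.\<close>

definition "conflict f g \<longleftrightarrow> g \<noteq> f \<and> (\<exists>i<t. block f i = block g i)"

definition "survivors w = {f \<in> selected w. \<forall>g\<in>selected w. \<not> conflict f g}"

lemma q_pos: "q > 0" using t L by (simp add: q_def)

lemma finV [simp]: "finite V" by (simp add: V_def)
lemma cardV: "card V = t * r" by (simp add: V_def)
lemma finF [simp]: "finite F" by (simp add: F_def)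
lemma finS: "finite S"
  by (rule finite_subset[OF S]) (auto intro!: finite_PiE)
lemma finW: "finite W"
  unfolding W_def by (rule finite_PiE) auto
lemma cardW: "card W = (q ^ d) ^ (t * r)"
  by (simp add: W_def card_PiE cardV card_cartesian_product power_mult[symmetric] mult.commute)

lemma F_D:
  assumes "f \<in> F"
  shows "f \<in> V \<rightarrow>\<^sub>E {..<t}" "\<And>i. i < t \<Longrightarrow> f i = i" "\<And>i. i < t \<Longrightarrow> card (block f i) = r"
    "\<And>v. v \<in> V \<Longrightarrow> f v < t"
  using assms PiE_mem[of f V "\<lambda>_. {..<t}"]
  by (simp_all add: F_def balanced_colourings_def block_def V_def)

lemma special_in_V: "i < t \<Longrightarrow> i \<in> V"
  using less_le_trans[OF _ mult_le_mono2[OF r], of i t] by (simp add: V_def)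

lemma S_bound: "s \<in> S \<Longrightarrow> c < d \<Longrightarrow> 0 \<le> s c \<and> s c < int L"
  using PiE_mem[OF subsetD[OF S], of s c] by simp

lemma multiple_bound:
  assumes "s \<in> S" "c < d" "k < t"
  shows "0 \<le> int k * s c \<and> int k * s c < int q"
proof -
  have "int k * s c \<le> int k * int L" using S_bound[OF assms(1,2)] by (intro mult_left_mono) auto
  also have "\<dots> < int t * int L" using assms(3) L by (intro mult_strict_right_mono) auto
  finally show ?thesis using S_bound[OF assms(1,2)] by (simp add: q_def)
qed

text \<open>Applied with \<open>k = 1\<close> to a block that is hashed directly and with
  \<open>k = t - 1\<close> to the complement of block \<open>0\<close>.\<close>

lemma S_eqI:
  assumes "s \<in> S" "s' \<in> S" "1 \<le> k" "k < t"
    and "\<And>c. c < d \<Longrightarrow> [int k * s c = int k * s' c] (mod int q)"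
  shows "s = s'"
proof (rule PiE_ext[OF subsetD[OF S assms(1)] subsetD[OF S assms(2)]])
  fix c assume "c \<in> {..<d}"
  hence c: "c < d" by simp
  have "int k * s c = int k * s' c"
    using assms(5)[OF c] multiple_bound[OF assms(1) c assms(4)] multiple_bound[OF assms(2) c assms(4)]
    by (simp add: cong_def)
  thus "s c = s' c" using assms(3) by simp
qed

lemma block_sum: "(\<Sum>v\<in>block f i. x v) = (\<Sum>v\<in>V. of_bool (f v = i) * (x v :: int))"
  unfolding block_def sum.inter_filter[OF finV] by (intro sum.cong) auto

lemma sum_blocks:
  assumes "f \<in> F"
  shows "(\<Sum>i\<in>{1..<t}. \<Sum>v\<in>block f i. (x v :: int)) = (\<Sum>v\<in>V - block f 0. x v)"
proof -
  have "(\<Sum>i\<in>{1..<t}. \<Sum>v\<in>block f i. x v) = (\<Sum>i\<in>{1..<t}. \<Sum>v\<in>{v \<in> V - block f 0. f v = i}. x v)"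
    by (intro sum.cong) (auto simp: block_def)
  also have "\<dots> = (\<Sum>v\<in>V - block f 0. x v)"
    using F_D(4)[OF assms] by (intro sum.group) (auto simp: block_def Suc_le_eq)
  finally show ?thesis .
qed

lemma hashes_complement:
  assumes "f \<in> F" "hashes w f s" "c < d"
  shows "[(\<Sum>v\<in>V - block f 0. w (v, c)) = int (t - 1) * s c] (mod int q)"
proof -
  have "[(\<Sum>i\<in>{1..<t}. \<Sum>v\<in>block f i. w (v, c)) = (\<Sum>i\<in>{1..<t}. s c)] (mod int q)"
    using assms by (intro cong_sum) (auto simp: hashes_def)
  thus ?thesis using sum_blocks[OF assms(1), of "\<lambda>v. w (v, c)"] by simp
qed

text \<open>Among the blocks, the weight at vertex \<open>i\<close> affects only block
  \<open>i\<close>. Hence the weights at \<open>1, ..., t - 1\<close> can adjust all hashes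
  independently.\<close>

lemma special_sum:
  assumes "f \<in> F" "i \<in> {1..<t}"
  shows "(\<Sum>v\<in>V. of_bool (f v = i) * (if v \<in> {1..<t} then x v else 0)) = (x i :: int)"
proof -
  have "(\<Sum>v\<in>V. of_bool (f v = i) * (if v \<in> {1..<t} then x v else 0)) =
    (\<Sum>v\<in>V. if v = i then x i else 0)"
    using F_D(2)[OF assms(1)] assms(2) by (intro sum.cong) auto
  thus ?thesis using special_in_V assms by simp
qed

text \<open>Each \<open>s\<close> in \<open>S\<close> imposes \<open>t - 1\<close> independent
  conditions, each of probability \<open>1 / q ^ d\<close>. Different \<open>s\<close> give disjoint
  events, since the hash of block \<open>1\<close> determines \<open>s\<close>.\<close>

lemma card_selecting:
  assumes f: "f \<in> F"
  shows "card {w \<in> W. f \<in> selected w} * (q ^ d) ^ (t - 1) = card S * (q ^ d) ^ (t * r)"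
proof -
  define X where "X s = {w \<in> W. hashes w f s}" for s
  have X: "card (X s) * (q ^ d) ^ (t - 1) = (q ^ d) ^ (t * r)" for s
  proof -
    have "X s = {w \<in> (V \<times> {..<d}) \<rightarrow>\<^sub>E {0..<int q}. \<forall>i\<in>{1..<t}. \<forall>c<d.
       [(\<Sum>v\<in>V. of_bool (f v = i) * w (v, c)) = s c] (mod int q)}"
      by (simp add: X_def W_def hashes_def block_sum)
    moreover have "\<exists>x. \<forall>i\<in>{1..<t}. (\<Sum>v\<in>V. of_bool (f v = i) * x v) = (y i :: int)" for y
      using special_sum[OF f, of _ y] by (intro exI[of _ "\<lambda>v. if v \<in> {1..<t} then y v else 0"]) blast
    ultimately show ?thesis
      using card_vector_linear_fibre_mod[of V "{1..<t}" q "\<lambda>i v. of_bool (f v = i)" d "\<lambda>_. s"] q_pos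
      by (simp add: cardV)
  qed
  have "{w \<in> W. f \<in> selected w} = (\<Union>s\<in>S. X s)"
    using f by (auto simp: selected_def X_def)
  also have "card \<dots> = (\<Sum>s\<in>S. card (X s))"
  proof (rule card_UN_disjoint[OF finS])
    show "\<forall>s\<in>S. finite (X s)" using finW by (simp add: X_def)
    show "\<forall>s\<in>S. \<forall>s'\<in>S. s \<noteq> s' \<longrightarrow> X s \<inter> X s' = {}"
    proof (intro ballI impI)
      fix s s' assume s: "s \<in> S" "s' \<in> S" "s \<noteq> s'"
      have False if "w \<in> X s" "w \<in> X s'" for w
      proof -
        have "[int 1 * s c = int 1 * s' c] (mod int q)" if "c < d" for c
        proof -
          have "[(\<Sum>v\<in>block f 1. w (v, c)) = s c] (mod int q)"
            "[(\<Sum>v\<in>block f 1. w (v, c)) = s' c] (mod int q)"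
            using \<open>w \<in> X s\<close> \<open>w \<in> X s'\<close> that t by (auto simp: X_def hashes_def)
          thus ?thesis by (simp add: cong_def)
        qed
        from S_eqI[OF s(1,2) _ _ this] s(3) t show False by simp
      qed
      thus "X s \<inter> X s' = {}" by blast
    qed
  qed
  finally show ?thesis using X by (simp add: sum_distrib_right)
qed

section \<open>Pairs of conflicting colourings\<close>

definition "rel f g = flow_rel V f g \<inter> {..<t} \<times> {..<t}"

lemma equiv_rel: "f \<in> F \<Longrightarrow> g \<in> F \<Longrightarrow> equiv {..<t} (rel f g)"
  unfolding rel_def by (rule equiv_flow_rel) (use F_D(4) in auto)

text \<open>A shared block has only one hash. It is \<open>s\<close> itself for a nonzero colour;
  for colour \<open>0\<close> the hash of the complement is \<open>t - 1\<close> times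
  \<open>s\<close>. Either value determines \<open>s\<close>.\<close>

lemma hashes_shared:
  assumes f: "f \<in> F" "hashes w f s" "s \<in> S" and g: "g \<in> F" "hashes w g s'" "s' \<in> S"
    and "conflict f g"
  shows "s = s'"
proof -
  obtain i where i: "i < t" "block f i = block g i" using assms(7) by (auto simp: conflict_def)
  show ?thesis
  proof (cases "i = 0")
    case True
    have "[int (t - 1) * s c = int (t - 1) * s' c] (mod int q)" if "c < d" for c
      using hashes_complement[OF f(1,2) that] hashes_complement[OF g(1,2) that] i True
      by (simp add: cong_def)
    from S_eqI[OF f(3) g(3) _ _ this] t show ?thesis by simp
  next
    case False
    have "[int 1 * s c = int 1 * s' c] (mod int q)" if "c < d" for c
    proof -
      have "[(\<Sum>v\<in>block f i. w (v, c)) = s c] (mod int q)"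
        "[(\<Sum>v\<in>block g i. w (v, c)) = s' c] (mod int q)"
        using f(2) g(2) that i(1) False by (auto simp: hashes_def)
      hence "[(\<Sum>v\<in>block g i. w (v, c)) = s c] (mod int q)"
        "[(\<Sum>v\<in>block g i. w (v, c)) = s' c] (mod int q)" by (simp_all only: i(2))
      thus ?thesis by (simp add: cong_def)
    qed
    from S_eqI[OF f(3) g(3) _ _ this] t show ?thesis by simp
  qed
qed

text \<open>By \<open>hashes_shared\<close> both colourings use the same \<open>s\<close>, so
  corresponding block sums agree modulo \<open>q\<close> and the divergences vanish. Those at the
  \<open>nonmin\<close> colours are conditions independent of each other and of the
  \<open>t - 1\<close> conditions on \<open>f\<close>.\<close>

lemma card_selecting_both:
  assumes f: "f \<in> F" and g: "g \<in> F" and conf: "conflict f g"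
  shows "card {w \<in> W. f \<in> selected w \<and> g \<in> selected w} * (q ^ d) ^ (t - 1 + card (nonmin {..<t} (rel f g)))
    \<le> card S * (q ^ d) ^ (t * r)"
proof -
  define T where "T = nonmin {..<t} (rel f g)"
  \<comment> \<open>Colour \<open>0\<close> is least in its class, so every divergence indexed by
    \<open>T\<close> compares two hashed blocks.\<close>
  have T: "T \<subseteq> {1..<t}" "finite T" by (auto simp: T_def nonmin_def)
  define J where "J = Inl ` {1..<t} \<union> Inr ` T"
  have cardJ: "card J = t - 1 + card T"
    unfolding J_def using T by (subst card_Un_disjoint) (auto simp: card_image)
  define m where "m = case_sum (\<lambda>i v. of_bool (f v = i)) (excess f g)"
  define b where "b s = case_sum (\<lambda>i :: nat. s) (\<lambda>(i :: nat) c. 0 :: int)" for s :: "nat \<Rightarrow> int"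
  define Y where "Y s = {w \<in> (V \<times> {..<d}) \<rightarrow>\<^sub>E {0..<int q}. \<forall>j\<in>J. \<forall>c<d.
       [(\<Sum>v\<in>V. m j v * w (v, c)) = b s j c] (mod int q)}" for s
  have "\<exists>x. \<forall>j\<in>J. (\<Sum>v\<in>V. m j v * x v) = y j" for y
  proof -
    have "\<exists>x. \<forall>i\<in>T. (\<Sum>v\<in>V. excess f g i v * x v) = y (Inr i)"
      unfolding T_def rel_def by (rule excess_surj) (use F_D(4) f g in auto)
    then obtain x where x: "\<And>i. i \<in> T \<Longrightarrow> (\<Sum>v\<in>V. excess f g i v * x v) = y (Inr i)" by blast
    \<comment> \<open>First solve for the divergences, then correct the block sums at the vertices
      \<open>1, ..., t - 1\<close>: there \<open>f\<close> and \<open>g\<close> agree, so the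
      correction leaves every divergence unchanged.\<close>
    define z where "z i = y (Inl i) - (\<Sum>v\<in>V. of_bool (f v = i) * x v)" for i
    define x' where "x' v = x v + (if v \<in> {1..<t} then z v else 0)" for v
    have "(\<Sum>v\<in>V. m j v * x' v) = y j" if "j \<in> J" for j
    proof (cases j)
      case (Inl i)
      hence i: "i \<in> {1..<t}" using that by (auto simp: J_def)
      have "(\<Sum>v\<in>V. m j v * x' v) = (\<Sum>v\<in>V. of_bool (f v = i) * x v)
          + (\<Sum>v\<in>V. of_bool (f v = i) * (if v \<in> {1..<t} then z v else 0))"
        by (simp only: Inl m_def sum.case x'_def distrib_left sum.distrib)
      thus ?thesis by (simp only: special_sum[OF f i]) (simp add: z_def Inl)
    next
      case (Inr i)
      hence i: "i \<in> T" using that by (auto simp: J_def)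
      have "excess f g i v * (if v \<in> {1..<t} then z v else 0) = 0" for v
        using F_D(2)[OF f, of v] F_D(2)[OF g, of v] by (simp add: excess_def)
      hence "m j v * x' v = excess f g i v * x v" for v
        by (simp only: Inr m_def sum.case x'_def distrib_left add_0_right)
      thus ?thesis using x[OF i] Inr by simp
    qed
    thus ?thesis by (intro exI[of _ x']) blast
  qed
  hence Y: "card (Y s) * (q ^ d) ^ card J = (q ^ d) ^ (t * r)" for s
    unfolding Y_def using card_vector_linear_fibre_mod[of V J q m d "b s"] q_pos T
    by (simp add: cardV J_def)
  have "{w \<in> W. f \<in> selected w \<and> g \<in> selected w} \<subseteq> (\<Union>s\<in>S. Y s)"
  proof
    fix w assume "w \<in> {w \<in> W. f \<in> selected w \<and> g \<in> selected w}"
    then obtain s s' where w: "w \<in> W" and s: "s \<in> S" "hashes w f s" and s': "s' \<in> S" "hashes w g s'"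
      by (auto simp: selected_def)
    have "s = s'" using hashes_shared[OF f s(2,1) g s'(2,1) conf] .
    have "[(\<Sum>v\<in>V. m j v * w (v, c)) = b s j c] (mod int q)" if "j \<in> J" "c < d" for j c
    proof (cases j)
      case (Inl i)
      thus ?thesis using s that by (auto simp: J_def m_def b_def hashes_def block_sum)
    next
      case (Inr i)
      hence i: "i \<in> {1..<t}" using that T by (auto simp: J_def)
      have "(\<Sum>v\<in>V. m j v * w (v, c)) = (\<Sum>v\<in>block f i. w (v, c)) - (\<Sum>v\<in>block g i. w (v, c))"
        by (simp add: Inr m_def block_sum excess_def left_diff_distrib sum_subtractf)
      also have "[\<dots> = s c - s c] (mod int q)"
        using s s' \<open>s = s'\<close> i that by (intro cong_diff) (auto simp: hashes_def)
      finally show ?thesis by (simp add: Inr b_def)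
    qed
    hence "w \<in> Y s" using w by (simp add: Y_def W_def)
    thus "w \<in> (\<Union>s\<in>S. Y s)" using s by blast
  qed
  moreover have "finite (Y s)" for s
    unfolding Y_def by (rule finite_subset[OF _ finW]) (auto simp: W_def)
  ultimately have "card {w \<in> W. f \<in> selected w \<and> g \<in> selected w} \<le> card (\<Union>s\<in>S. Y s)"
    using finS by (intro card_mono) auto
  also have "\<dots> \<le> (\<Sum>s\<in>S. card (Y s))" by (rule card_UN_le[OF finS])
  finally have "card {w \<in> W. f \<in> selected w \<and> g \<in> selected w} * (q ^ d) ^ card J
    \<le> (\<Sum>s\<in>S. card (Y s)) * (q ^ d) ^ card J" by (rule mult_le_mono1)
  also have "\<dots> = card S * (q ^ d) ^ (t * r)" using Y by (simp add: sum_distrib_right)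
  finally show ?thesis by (simp only: cardJ T_def)
qed

text \<open>An edge leaving \<open>i\<close> would be a vertex given colour \<open>i\<close> by
  exactly one of \<open>f\<close> and \<open>g\<close>, so \<open>i\<close> carries only
  loops.\<close>

lemma shared_class:
  assumes "block f i = block g i" "(i, k) \<in> flow_rel V f g"
  shows "k = i"
proof -
  have *: "f v = i \<longleftrightarrow> g v = i" if "v \<in> V" for v
    using assms(1) that by (auto simp: block_def)
  have "(i, k) \<in> ((\<lambda>v. (f v, g v)) ` V \<union> ((\<lambda>v. (f v, g v)) ` V)\<inverse>)\<^sup>*"
    using assms(2) by (simp add: flow_rel_def Let_def)
  thus ?thesis by (induction rule: rtrancl_induct) (use * in auto)
qed

text \<open>The shared colour \<open>i\<close> is a class by itself and every other class misses it.
  This is where sharing a block limits the class sizes.\<close>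

lemma class_card_bound:
  assumes f: "f \<in> F" and g: "g \<in> F" and "conflict f g" and j: "j < t"
  shows "1 \<le> card (rel f g `` {j})" "card (rel f g `` {j}) \<le> t - 1"
proof -
  obtain i where i: "i < t" "block f i = block g i" using assms by (auto simp: conflict_def)
  note eq = equiv_rel[OF f g]
  have sub: "rel f g `` {j} \<subseteq> {..<t}" by (auto simp: rel_def)
  have "j \<in> rel f g `` {j}" by (rule equiv_class_self[OF eq]) (use j in simp)
  thus "1 \<le> card (rel f g `` {j})"
    using finite_subset[OF sub] by (auto simp: Suc_le_eq card_gt_0_iff)
  show "card (rel f g `` {j}) \<le> t - 1"
  proof (cases "i \<in> rel f g `` {j}")
    case True
    hence "(i, j) \<in> rel f g" using eq by (auto elim!: equivE dest: symD)
    hence "j = i" using shared_class[OF i(2)] by (simp add: rel_def)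
    hence "rel f g `` {j} \<subseteq> {i}" using shared_class[OF i(2)] by (auto simp: rel_def)
    hence "card (rel f g `` {j}) \<le> 1" using card_mono[of "{i}"] by simp
    thus ?thesis using t by simp
  next
    case False
    hence "rel f g `` {j} \<subseteq> {..<t} - {i}" using sub by blast
    hence "card (rel f g `` {j}) \<le> card ({..<t} - {i})" by (intro card_mono) auto
    thus ?thesis using i by simp
  qed
qed

text \<open>Where \<open>f\<close> and \<open>g\<close> differ, two colours are joined, and the
  larger of them is not least in its class.\<close>

lemma conflict_nonmin:
  assumes f: "f \<in> F" and g: "g \<in> F" and "conflict f g"
  shows "1 \<le> card (nonmin {..<t} (rel f g))"
proof -
  have "g \<noteq> f" using assms by (simp add: conflict_def)
  then obtain v where v: "v \<in> V" "g v \<noteq> f v"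
    using PiE_ext[OF F_D(1)[OF g] F_D(1)[OF f]] by blast
  have "(f v, g v) \<in> rel f g"
    using v F_D(4)[OF f v(1)] F_D(4)[OF g v(1)] by (auto simp: rel_def flow_rel_def Let_def)
  moreover from this have "(g v, f v) \<in> rel f g"
    using equiv_rel[OF f g] by (auto elim!: equivE dest: symD)
  moreover have "f v < g v \<or> g v < f v" using v by linarith
  ultimately have "f v \<in> nonmin {..<t} (rel f g) \<or> g v \<in> nonmin {..<t} (rel f g)"
    using F_D(4)[OF f v(1)] F_D(4)[OF g v(1)] unfolding nonmin_def by blast
  moreover have "finite (nonmin {..<t} (rel f g))" by (simp add: nonmin_def)
  ultimately show ?thesis by (auto simp: Suc_le_eq card_gt_0_iff)
qed

text \<open>Such an \<open>h\<close> maps \<open>v\<close> into the class of \<open>f v\<close>. As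
  \<open>f\<close> takes each colour \<open>r\<close> times, the number of choices is the
  \<open>r\<close>-th power of the product of class sizes over the colours.\<close>

lemma card_same_rel:
  assumes f: "f \<in> F" and g: "g \<in> F" "conflict f g"
  shows "real (card {h \<in> F. rel f h = rel f g}) \<le> (growth t ^ r) ^ card (nonmin {..<t} (rel f g))"
proof -
  define k where "k i = card (rel f g `` {i})" for i
  have "{h \<in> F. rel f h = rel f g} \<subseteq> (\<Pi>\<^sub>E v\<in>V. rel f g `` {f v})"
  proof
    fix h assume "h \<in> {h \<in> F. rel f h = rel f g}"
    hence h: "h \<in> F" "rel f h = rel f g" by auto
    show "h \<in> (\<Pi>\<^sub>E v\<in>V. rel f g `` {f v})"
    proof (rule PiE_I)
      fix v assume v: "v \<in> V"
      have "(f v, h v) \<in> rel f h"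
        using v F_D(4)[OF f v] F_D(4)[OF h(1) v] by (auto simp: rel_def flow_rel_def Let_def)
      thus "h v \<in> rel f g `` {f v}" using h(2) by simp
    next
      fix v assume "v \<notin> V"
      thus "h v = undefined" using F_D(1)[OF h(1)] by (rule PiE_arb[rotated])
    qed
  qed
  moreover have "finite (\<Pi>\<^sub>E v\<in>V. rel f g `` {f v})"
  proof (rule finite_PiE)
    show "finite (rel f g `` {f v})" for v by (rule finite_subset[of _ "{..<t}"]) (auto simp: rel_def)
  qed simp
  ultimately have "card {h \<in> F. rel f h = rel f g} \<le> card (\<Pi>\<^sub>E v\<in>V. rel f g `` {f v})"
    by (rule card_mono[rotated])
  also have "\<dots> = (\<Prod>v\<in>V. k (f v))" by (simp add: card_PiE k_def)
  also have "\<dots> = (\<Prod>i\<in>{..<t}. \<Prod>v\<in>{v \<in> V. f v = i}. k (f v))"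
    using F_D(4)[OF f] by (intro prod.group[symmetric]) auto
  also have "\<dots> = (\<Prod>i\<in>{..<t}. k i ^ r)"
  proof (intro prod.cong refl)
    fix i assume "i \<in> {..<t}"
    thus "(\<Prod>v\<in>{v \<in> V. f v = i}. k (f v)) = k i ^ r"
      using F_D(3)[OF f, of i] by (simp add: block_def)
  qed
  also have "\<dots> = (\<Prod>i<t. k i) ^ r" by (simp add: prod_power_distrib)
  finally have "real (card {h \<in> F. rel f h = rel f g}) \<le> real ((\<Prod>i<t. k i) ^ r)"
    by (simp only: of_nat_le_iff)
  also have "\<dots> = (\<Prod>i<t. real (card (rel f g `` {i}))) ^ r" by (simp add: k_def)
  also have "\<dots> \<le> (growth t ^ card (nonmin {..<t} (rel f g))) ^ r"
  proof (intro power_mono prod_class_card_le equiv_rel f g prod_nonneg)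
    show "real k ^ k \<le> growth t ^ (k - 1)" if "k \<in> (\<lambda>i. card (rel f g `` {i})) ` {..<t}" for k
      using that class_card_bound[OF f g] by (intro power_self_le_growth t) auto
  qed (use growth_ge_1[OF t] in auto)
  finally show ?thesis by (simp flip: power_mult add: mult.commute)
qed

text \<open>Group the \<open>g\<close> by \<open>rel f g\<close>, which takes at most
  \<open>2 ^ (t * t)\<close> values. With \<tau> the number of \<open>nonmin\<close> colours, a
  group has at most \<open>growth t ^ (r * \<tau>)\<close> members, each selected together with
  \<open>f\<close> with conditional probability at most \<open>1 / Q ^ \<tau>\<close>. The
  assumption and \<tau> \<ge> 1 bound its contribution by \<open>1 / B\<close>, and all groups
  together by 1/2.\<close>

lemma sum_conflicts_le:
  assumes Q: "2 * 2 ^ (t * t) * growth t ^ r \<le> real (q ^ d)" and f: "f \<in> F"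
  shows "2 * (\<Sum>g\<in>{g \<in> F. conflict f g}. real (card {w \<in> W. f \<in> selected w \<and> g \<in> selected w}))
    \<le> real (card {w \<in> W. f \<in> selected w})"
proof -
  define c where "c = real (card {w \<in> W. f \<in> selected w})"
  define Q where "Q = real (q ^ d)"
  define G where "G = {g \<in> F. conflict f g}"
  define B :: real where "B = 2 * 2 ^ (t * t)"
  define \<tau> where "\<tau> g = card (nonmin {..<t} (rel f g))" for g
  have Q0: "Q > 0" using q_pos by (simp add: Q_def)
  have c0: "c \<ge> 0" by (simp add: c_def)
  have a0: "growth t ^ r > 0" using growth_ge_1[OF t] by simp
  have fG: "finite G" by (simp add: G_def)
  have pair: "real (card {w \<in> W. f \<in> selected w \<and> g \<in> selected w}) \<le> c / Q ^ \<tau> g" if "g \<in> G" for g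
  proof -
    have "real (card {w \<in> W. f \<in> selected w \<and> g \<in> selected w} * (q ^ d) ^ (t - 1 + \<tau> g))
      \<le> real (card S * (q ^ d) ^ (t * r))"
      using card_selecting_both[OF f] that unfolding of_nat_le_iff G_def \<tau>_def by blast
    also have "\<dots> = real (card {w \<in> W. f \<in> selected w} * (q ^ d) ^ (t - 1))"
      by (simp only: card_selecting[OF f])
    finally have "(real (card {w \<in> W. f \<in> selected w \<and> g \<in> selected w}) * Q ^ \<tau> g) * Q ^ (t - 1)
      \<le> c * Q ^ (t - 1)"
      by (simp only: of_nat_mult of_nat_power Q_def c_def power_add mult_ac)
    hence "real (card {w \<in> W. f \<in> selected w \<and> g \<in> selected w}) * Q ^ \<tau> g \<le> c"
      using Q0 by simp
    thus ?thesis using Q0 by (simp add: field_simps)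
  qed
  have group: "(\<Sum>h\<in>{h \<in> G. rel f h = R}. c / Q ^ \<tau> h) \<le> c / B" if R: "R \<in> rel f ` G" for R
  proof -
    obtain g where g: "g \<in> F" "conflict f g" "R = rel f g" using R by (auto simp: G_def)
    have "(\<Sum>h\<in>{h \<in> G. rel f h = R}. c / Q ^ \<tau> h) = real (card {h \<in> G. rel f h = R}) * (c / Q ^ \<tau> g)"
      by (simp add: \<tau>_def g)
    also have "\<dots> \<le> (growth t ^ r) ^ \<tau> g * (c / Q ^ \<tau> g)"
    proof (intro mult_right_mono)
      have "real (card {h \<in> G. rel f h = R}) \<le> real (card {h \<in> F. rel f h = rel f g})"
        unfolding of_nat_le_iff by (intro card_mono) (auto simp: G_def g)
      also have "\<dots> \<le> (growth t ^ r) ^ \<tau> g" unfolding \<tau>_def by (rule card_same_rel[OF f g(1,2)])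
      finally show "real (card {h \<in> G. rel f h = R}) \<le> (growth t ^ r) ^ \<tau> g" .
    qed (use c0 Q0 in auto)
    also have "\<dots> = c * (growth t ^ r / Q) ^ \<tau> g" by (simp add: power_divide)
    also have "\<dots> \<le> c * (1 / B) ^ \<tau> g"
      using Q Q0 a0 c0 by (intro mult_left_mono power_mono) (auto simp: B_def Q_def field_simps)
    also have "\<dots> \<le> c * (1 / B) ^ 1"
    proof -
      have "1 \<le> \<tau> g" using conflict_nonmin[OF f g(1,2)] by (simp add: \<tau>_def)
      moreover have "1 / B \<le> 1" unfolding B_def by (simp add: field_simps)
          (use one_le_power[of "2::real" "t * t"] in linarith)
      ultimately show ?thesis using c0 by (intro mult_left_mono power_decreasing) (auto simp: B_def)
    qed
    finally show ?thesis by simp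
  qed
  have "card (rel f ` G) \<le> card (Pow ({..<t} \<times> {..<t}))"
    by (intro card_mono) (auto simp: rel_def)
  also have "\<dots> = 2 ^ (t * t)" by (simp add: card_Pow card_cartesian_product)
  finally have "real (card (rel f ` G)) \<le> real (2 ^ (t * t))" by (simp only: of_nat_le_iff)
  hence cR: "real (card (rel f ` G)) \<le> 2 ^ (t * t)" by simp
  have "(\<Sum>g\<in>G. real (card {w \<in> W. f \<in> selected w \<and> g \<in> selected w})) \<le> (\<Sum>g\<in>G. c / Q ^ \<tau> g)"
    by (intro sum_mono pair)
  also have "\<dots> = (\<Sum>R\<in>rel f ` G. \<Sum>h\<in>{h \<in> G. rel f h = R}. c / Q ^ \<tau> h)"
    using fG by (intro sum.image_gen) 
  also have "\<dots> \<le> (\<Sum>R\<in>rel f ` G. c / B)" by (intro sum_mono group)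
  also have "\<dots> = real (card (rel f ` G)) * (c / B)" by simp
  also have "\<dots> \<le> 2 ^ (t * t) * (c / B)" using cR c0 by (intro mult_right_mono) (auto simp: B_def)
  also have "\<dots> = c / 2" by (simp add: B_def)
  finally show ?thesis by (simp add: c_def G_def)
qed

section \<open>Averaging over the weights\<close>

text \<open>Deletion method: on average the conflicting pairs are at most half as many as the
  selected colourings, so at least half of the expected number
  \<open>card F * card S / (q ^ d) ^ (t - 1)\<close> survives for some \<open>w\<close>.\<close>

lemma exists_many_survivors:
  assumes Q: "2 * 2 ^ (t * t) * growth t ^ r \<le> real (q ^ d)"
  shows "\<exists>w. real (card F) * real (card S) \<le> 2 * real (card (survivors w)) * real (q ^ d) ^ (t - 1)"
proof (rule ccontr)
  assume neg: "\<not> ?thesis"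
  define Q where "Q = real (q ^ d)"
  define P where "P w = {(f, g). f \<in> selected w \<and> g \<in> selected w \<and> conflict f g}" for w
  have Q0: "Q > 0" using q_pos by (simp add: Q_def)
  have finsel: "finite (selected w)" for w by (simp add: selected_def)
  have finP: "finite (P w)" for w
    by (rule finite_subset[of _ "selected w \<times> selected w"]) (auto simp: P_def finsel)
  have sel: "card (selected w) \<le> card (survivors w) + card (P w)" for w
  proof -
    \<comment> \<open>Pairs in \<open>P w\<close> are ordered, so every discarded colouring is the
      first component of one.\<close>
    have "selected w \<subseteq> survivors w \<union> fst ` P w"
      by (force simp: survivors_def P_def image_iff)
    hence "card (selected w) \<le> card (survivors w \<union> fst ` P w)"
      using finsel finP by (intro card_mono) (auto simp: survivors_def)
    also have "\<dots> \<le> card (survivors w) + card (fst ` P w)" by (rule card_Un_le)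
    also have "card (fst ` P w) \<le> card (P w)" by (rule card_image_le[OF finP])
    finally show ?thesis by simp
  qed
  have swap: "(\<Sum>w\<in>W. card {x \<in> X. \<phi> w x}) = (\<Sum>x\<in>X. card {w \<in> W. \<phi> w x})" 
    if "finite X" for X :: "'x set" and \<phi>
    by (subst (1 2) card_eq_sum)
      (simp only: sum.inter_filter[OF that] sum.inter_filter[OF finW] sum.swap[of _ X W])
  have sumsel: "(\<Sum>w\<in>W. card (selected w)) = (\<Sum>f\<in>F. card {w \<in> W. f \<in> selected w})"
  proof -
    have "selected w = {f \<in> F. f \<in> selected w}" for w by (auto simp: selected_def)
    thus ?thesis using swap[OF finF, of "\<lambda>w f. f \<in> selected w"] by simp
  qed
  have sumP: "(\<Sum>w\<in>W. card (P w)) =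
    (\<Sum>f\<in>F. \<Sum>g\<in>{g \<in> F. conflict f g}. card {w \<in> W. f \<in> selected w \<and> g \<in> selected w})"
  proof -
    define X where "X = (SIGMA f:F. {g \<in> F. conflict f g})"
    have "finite X" by (auto simp: X_def intro!: finite_SigmaI)
    have "P w = {x \<in> X. case x of (f, g) \<Rightarrow> f \<in> selected w \<and> g \<in> selected w}" for w
      by (auto simp: P_def X_def selected_def)
    hence "(\<Sum>w\<in>W. card (P w)) = (\<Sum>x\<in>X. card {w \<in> W. case x of (f, g) \<Rightarrow> f \<in> selected w \<and> g \<in> selected w})"
      using swap[OF \<open>finite X\<close>] by simp
    also have "\<dots> = (\<Sum>f\<in>F. \<Sum>g\<in>{g \<in> F. conflict f g}. card {w \<in> W. f \<in> selected w \<and> g \<in> selected w})"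
      unfolding X_def by (subst sum.Sigma) (auto intro!: sum.cong)
    finally show ?thesis .
  qed
  have "2 * real (\<Sum>w\<in>W. card (P w)) =
    (\<Sum>f\<in>F. 2 * (\<Sum>g\<in>{g \<in> F. conflict f g}. real (card {w \<in> W. f \<in> selected w \<and> g \<in> selected w})))"
    by (simp add: sumP sum_distrib_left)
  also have "\<dots> \<le> (\<Sum>f\<in>F. real (card {w \<in> W. f \<in> selected w}))"
    by (intro sum_mono sum_conflicts_le Q)
  also have "\<dots> = real (\<Sum>w\<in>W. card (selected w))" by (simp add: sumsel)
  finally have "2 * real (\<Sum>w\<in>W. card (P w)) \<le> real (\<Sum>w\<in>W. card (selected w))" .
  moreover have "real (\<Sum>w\<in>W. card (selected w)) \<le> real (\<Sum>w\<in>W. card (survivors w)) + real (\<Sum>w\<in>W. card (P w))"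
    using sum_mono[of W, OF sel] by (simp only: sum.distrib of_nat_add[symmetric] of_nat_le_iff)
  ultimately have le: "real (\<Sum>w\<in>W. card (selected w)) \<le> 2 * real (\<Sum>w\<in>W. card (survivors w))"
    by linarith
  have "W \<noteq> {}" using cardW q_pos by auto
  have "real (card F) * real (card S) * Q ^ (t * r) = real (\<Sum>f\<in>F. card S * (q ^ d) ^ (t * r))"
    by (simp add: Q_def)
  also have "\<dots> = real (\<Sum>f\<in>F. card {w \<in> W. f \<in> selected w} * (q ^ d) ^ (t - 1))"
    by (simp only: card_selecting cong: sum.cong)
  also have "\<dots> = real (\<Sum>w\<in>W. card (selected w)) * Q ^ (t - 1)"
    by (simp add: sumsel Q_def flip: sum_distrib_right)
  also have "\<dots> \<le> 2 * real (\<Sum>w\<in>W. card (survivors w)) * Q ^ (t - 1)"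
    using Q0 by (intro mult_right_mono le) auto
  also have "\<dots> = (\<Sum>w\<in>W. 2 * real (card (survivors w)) * Q ^ (t - 1))"
    by (simp add: sum_distrib_left sum_distrib_right)
  also have "\<dots> < (\<Sum>w\<in>W. real (card F) * real (card S))"
    using neg \<open>W \<noteq> {}\<close> finW by (intro sum_strict_mono) (auto simp: not_le Q_def)
  also have "\<dots> = real (card F) * real (card S) * Q ^ (t * r)"
    by (simp add: cardW Q_def)
  finally show False by simp
qed

section \<open>Blocks of different survivors do not fit together\<close>

text \<open>Glue block \<open>k\<close> of each \<open>h k\<close> to a colouring \<open>g\<close>.
  The hashes of its blocks \<open>1, ..., t - 1\<close> sum to the hash of the complement of block
  \<open>0\<close>, so their mean is the point of \<open>h 0\<close>; convexity makes them equal and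
  \<open>g\<close> is selected. It shares a block with each \<open>h k\<close>, which survived, so
  \<open>h k = g\<close>.\<close>

lemma survivors_not_mixed:
  assumes surv: "\<And>k. k < t \<Longrightarrow> h k \<in> survivors w"
    and disj: "\<And>k l. k < t \<Longrightarrow> l < t \<Longrightarrow> k \<noteq> l \<Longrightarrow> block (h k) k \<inter> block (h l) l = {}"
    and "k < t" "l < t"
  shows "h k = h l"
proof -
  have hF: "h k \<in> F" if "k < t" for k using surv[OF that] by (simp add: survivors_def selected_def)
  \<comment> \<open>Disjoint blocks of size \<open>r\<close>, \<open>t\<close> in number, exhaust
    the vertex set.\<close>
  have "card (\<Union>k<t. block (h k) k) = (\<Sum>k<t. card (block (h k) k))"
    using disj by (intro card_UN_disjoint) (auto simp: block_def)
  also have "\<dots> = t * r" using F_D(3)[OF hF] by simp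
  finally have cover: "(\<Union>k<t. block (h k) k) = V"
    by (intro card_subset_eq) (auto simp: block_def cardV)
  define g where "g = (\<lambda>v\<in>V. THE k. k < t \<and> v \<in> block (h k) k)"
  have gI: "g v = k" if "k < t" "v \<in> block (h k) k" for v k
  proof -
    have "(THE k. k < t \<and> v \<in> block (h k) k) = k" using that disj by (intro the_equality) blast+
    thus ?thesis using that by (simp add: g_def block_def)
  qed
  have block_g: "block g k = block (h k) k" if "k < t" for k
  proof
    show "block g k \<subseteq> block (h k) k"
    proof
      fix v assume v: "v \<in> block g k"
      hence "v \<in> V" by (simp add: block_def)
      then obtain l where l: "l < t" "v \<in> block (h l) l" using cover by blast
      with gI v show "v \<in> block (h k) k" by (auto simp: block_def)
    qed
    show "block (h k) k \<subseteq> block g k" using gI[OF that] by (auto simp: block_def)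
  qed
  have "g v < t" if "v \<in> V" for v
  proof -
    from that obtain l where "l < t" "v \<in> block (h l) l" using cover by blast
    thus ?thesis using gI by simp
  qed
  hence "g \<in> V \<rightarrow>\<^sub>E {..<t}" by (auto simp: g_def)
  moreover have "g i = i" if "i < t" for i
    using gI[OF that] F_D(2)[OF hF[OF that] that] special_in_V[OF that] by (simp add: block_def)
  moreover have "card (block g i) = r" if "i < t" for i
    using block_g[OF that] F_D(3)[OF hF[OF that] that] by simp
  ultimately have gF: "g \<in> F" by (simp add: F_def balanced_colourings_def block_def V_def)
  have "\<exists>s. k < t \<longrightarrow> s \<in> S \<and> hashes w (h k) s" for k
    using surv[of k] by (auto simp: survivors_def selected_def)
  then obtain s where s: "\<And>k. k < t \<Longrightarrow> s k \<in> S" "\<And>k. k < t \<Longrightarrow> hashes w (h k) (s k)"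
    by metis
  have hash_g: "[(\<Sum>v\<in>block g i. w (v, c)) = s i c] (mod int q)" if "i \<in> {1..<t}" "c < d" for i c
    using s(2)[of i] that block_g[of i] by (auto simp: hashes_def)
  have "(\<Sum>i\<in>{1..<t}. s i c) = int (card {1..<t}) * s 0 c" if c: "c < d" for c
  proof -
    have "[(\<Sum>i\<in>{1..<t}. s i c) = (\<Sum>i\<in>{1..<t}. \<Sum>v\<in>block g i. w (v, c))] (mod int q)"
      using hash_g c by (intro cong_sum) (auto intro: cong_sym)
    also have "(\<Sum>i\<in>{1..<t}. \<Sum>v\<in>block g i. w (v, c)) = (\<Sum>v\<in>V - block (h 0) 0. w (v, c))"
      using sum_blocks[OF gF] block_g[of 0] t by simp
    also have "[\<dots> = int (t - 1) * s 0 c] (mod int q)"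
      using hashes_complement[OF hF s(2) c] t by simp
    finally have "[(\<Sum>i\<in>{1..<t}. s i c) = int (t - 1) * s 0 c] (mod int q)" .
    \<comment> \<open>Both sides lie between \<open>0\<close> and \<open>q\<close>, so the
      congruence can be read as an equation between integers.\<close>
    moreover have "0 \<le> (\<Sum>i\<in>{1..<t}. s i c)" "(\<Sum>i\<in>{1..<t}. s i c) < int q"
    proof -
      have b: "0 \<le> s i c \<and> s i c < int L" if "i \<in> {1..<t}" for i
        using S_bound[OF s(1) c] that by auto
      thus "0 \<le> (\<Sum>i\<in>{1..<t}. s i c)" by (intro sum_nonneg) blast
      have "(\<Sum>i\<in>{1..<t}. s i c) < (\<Sum>i\<in>{1..<t}. int L)"
        using b t by (intro sum_strict_mono) auto
      also have "\<dots> \<le> int q" by (simp add: q_def flip: of_nat_mult)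
      finally show "(\<Sum>i\<in>{1..<t}. s i c) < int q" .
    qed
    moreover have "0 \<le> int (t - 1) * s 0 c \<and> int (t - 1) * s 0 c < int q"
      using multiple_bound[OF s(1) c, of 0 "t - 1"] t by simp
    ultimately show ?thesis by (simp add: cong_def)
  qed
  hence "s i c = s 0 c" if "i \<in> {1..<t}" "c < d" for i c
    using that s(1) sphere t by (intro sphere_mean_eq[of "{1..<t}" i c d s \<rho> "s 0"]) auto
  hence "hashes w g (s 0)" using hash_g by (auto simp: hashes_def)
  hence "g \<in> selected w" using s(1)[of 0] t gF by (auto simp: selected_def)
  hence "h k = g" if "k < t" for k
  proof -
    have "\<not> conflict (h k) g" using surv[OF that] \<open>g \<in> selected w\<close> by (simp add: survivors_def)
    thus ?thesis using block_g[OF that] that by (auto simp: conflict_def)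
  qed
  thus ?thesis using assms by simp
qed

end

section \<open>Choice of the dimension and the side length\<close>

text \<open>With \<open>d\<close> of order \<open>sqrt r\<close>, a group of order exponential in
  \<open>r\<close> has \<open>L = exp (O (sqrt r))\<close>. Then the density loss
  \<open>d * L\<^sup>2\<close>, the factor \<open>t ^ (d * (t - 1))\<close> and the rounding of
  \<open>L\<close> each cost only \<open>exp (O (sqrt r))\<close>.\<close>

lemma exists_parameters:
  fixes t :: nat
  assumes t: "t \<ge> 2"
  obtains C :: real where "C \<ge> 0" and "\<And>r :: nat. r \<ge> 1 \<Longrightarrow> \<exists>d L :: nat. d \<ge> 1 \<and> L \<ge> 1 \<and>
    2 * 2 ^ (t * t) * growth t ^ r \<le> real ((t * L) ^ d) \<and>
    2 * real t ^ t * (exp 1 * real r) ^ t * (real d * real L ^ 2) * real t ^ (d * (t - 1)) * real L ^ (d * (t - 2))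
      \<le> exp (C * sqrt r) * (real t - 1) ^ ((t - 1) * r)"
proof -
  define B :: real where "B = 2 * 2 ^ (t * t)"
  define \<alpha> where "\<alpha> = growth t"
  define c where "c = ln 2 + ln B + ln \<alpha>"
  \<comment> \<open>The four summands are the exponents in \<open>f1\<close>, \<open>dL\<close>,
    \<open>f2\<close> and \<open>f3\<close>.\<close>
  define C where "C = (ln 2 + t * ln t + 3 * t) + (2 + 2 * c) + 2 * real (t - 1) * ln t
    + (2 * real (t - 2) * ln 2 + real (t - 2) * ln B)"
  have "(1::real) \<le> 2 ^ (t * t)" by (rule one_le_power) simp
  hence B: "B \<ge> 1" unfolding B_def by linarith
  have \<alpha>: "\<alpha> \<ge> 1" using growth_ge_1[OF t] by (simp add: \<alpha>_def)
  have c: "c \<ge> 0" "ln 2 \<le> c" using B \<alpha> by (simp_all add: c_def)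
  have "C \<ge> 0" unfolding C_def using B c t by (intro add_nonneg_nonneg mult_nonneg_nonneg) auto
  moreover have "\<exists>d L :: nat. d \<ge> 1 \<and> L \<ge> 1 \<and>
    2 * 2 ^ (t * t) * growth t ^ r \<le> real ((t * L) ^ d) \<and>
    2 * real t ^ t * (exp 1 * real r) ^ t * (real d * real L ^ 2) * real t ^ (d * (t - 1)) * real L ^ (d * (t - 2))
      \<le> exp (C * sqrt r) * (real t - 1) ^ ((t - 1) * r)" if r: "r \<ge> 1" for r :: nat
  proof -
    define x where "x = sqrt (real r)"
    define d where "d = nat \<lceil>x\<rceil>"
    \<comment> \<open>The real side length with \<open>\<beta> ^ d\<close> exactly
      \<open>B * \<alpha> ^ r\<close>, the order required for \<open>sum_conflicts_le\<close>;
      rounding up at most doubles it.\<close>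
    define \<beta> where "\<beta> = (B * \<alpha> ^ r) powr (1 / real d)"
    define L where "L = nat \<lceil>\<beta>\<rceil>"
    have x: "x \<ge> 1" "x * x = real r" using r by (simp_all add: x_def)
    have d: "d \<ge> 1" "x \<le> real d" "real d \<le> 2 * x"
      using x(1) unfolding d_def by linarith+
    have A1: "B * \<alpha> ^ r \<ge> 1" using B \<alpha> by (metis mult_mono' mult_1 one_le_power zero_le_one)
    have \<beta>1: "\<beta> \<ge> 1" unfolding \<beta>_def using A1 d by (intro ge_one_powr_ge_zero) auto
    have L: "L \<ge> 1" "\<beta> \<le> real L" "real L \<le> 2 * \<beta>" using \<beta>1 unfolding L_def by linarith+
    have \<beta>d: "\<beta> ^ d = B * \<alpha> ^ r"
    proof -
      have "\<beta> ^ d = \<beta> powr real d" using \<beta>1 by (simp add: powr_realpow)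
      also have "\<dots> = (B * \<alpha> ^ r) powr (1 / real d * real d)" unfolding \<beta>_def by (rule powr_powr)
      also have "1 / real d * real d = 1" using d by simp
      finally show ?thesis using A1 by simp
    qed
    have lnA: "ln (B * \<alpha> ^ r) = ln B + r * ln \<alpha>" using B \<alpha> by (simp add: ln_mult ln_realpow)
    have "ln \<beta> = (ln B + r * ln \<alpha>) / d" by (simp add: \<beta>_def ln_powr lnA)
    also have "\<dots> \<le> ln B * x + ln \<alpha> * x"
    proof -
      have "ln B \<le> ln B * x * d" using B x d mult_mono[of 1 x 1 "real d"] mult_left_mono[of 1 "x * d" "ln B"]
        by (simp add: mult.assoc)
      moreover have "r * ln \<alpha> \<le> ln \<alpha> * x * d"
      proof -
        have "real r \<le> x * real d" using mult_left_mono[of x "real d" x] d x by simp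
        thus ?thesis using mult_right_mono[of "real r" "x * real d" "ln \<alpha>"] \<alpha> by (simp add: mult_ac)
      qed
      ultimately show ?thesis using d by (simp add: field_simps)
    qed
    finally have ln\<beta>: "ln \<beta> \<le> ln B * x + ln \<alpha> * x" .
    have "ln (real L) \<le> ln (2 * \<beta>)" using L by (subst ln_le_cancel_iff) auto
    also have "\<dots> \<le> ln 2 * x + (ln B * x + ln \<alpha> * x)"
    proof -
      have "ln 2 \<le> ln 2 * x" using x by simp
      moreover have "ln (2 * \<beta>) = ln 2 + ln \<beta>" using \<beta>1 by (simp add: ln_mult)
      ultimately show ?thesis using ln\<beta> by linarith
    qed
    also have "\<dots> = c * x" by (simp add: c_def algebra_simps)
    finally have "exp (ln (real L)) \<le> exp (c * x)" by simp
    hence Lc: "real L \<le> exp (c * x)" using L by simp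
    have "real d * real L ^ 2 \<le> exp (2 * x) * exp (c * x) ^ 2"
    proof (intro mult_mono power_mono Lc)
      show "real d \<le> exp (2 * x)" using d(3) exp_ge_add_one_self[of "2 * x"] by linarith
    qed auto
    also have "\<dots> = exp ((2 + 2 * c) * x)"
      by (simp add: exp_of_nat_mult[symmetric] exp_add[symmetric] algebra_simps)
    finally have dL: "real d * real L ^ 2 \<le> exp ((2 + 2 * c) * x)" .
    have pow_exp: "a ^ k \<le> exp (real k * ln a * y)" if "a \<ge> 1" "y \<ge> 1" for a y :: real and k
    proof -
      have "a ^ k = exp (real k * ln a)" using that by (simp add: exp_of_nat_mult)
      also have "\<dots> \<le> exp (real k * ln a * y)" using that mult_left_mono[of 1 y "real k * ln a"] by simp
      finally show ?thesis .
    qed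
    have "real r \<le> exp x * exp x"
      unfolding x(2)[symmetric] using x exp_ge_add_one_self[of x] by (intro mult_mono) linarith+
    also have "exp x * exp x = exp (2 * x)" by (simp flip: exp_add)
    finally have "exp 1 * real r \<le> exp x * exp (2 * x)" using x by (intro mult_mono) auto
    hence "(exp 1 * real r) ^ t \<le> (exp x * exp (2 * x)) ^ t" by (intro power_mono) auto
    also have "\<dots> = exp (3 * t * x)"
      by (simp add: exp_of_nat_mult[symmetric] exp_add[symmetric] algebra_simps)
    finally have er: "(exp 1 * real r) ^ t \<le> exp (3 * t * x)" .
    have two: "(2::real) \<le> exp (ln 2 * x)" using pow_exp[of 2 x 1] x by simp
    have tt: "real t ^ t \<le> exp (t * ln t * x)" using pow_exp[of "real t" x t] x t by simp
    have "2 * real t ^ t * (exp 1 * real r) ^ t \<le> exp (ln 2 * x) * exp (t * ln t * x) * exp (3 * t * x)"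
      by (intro mult_mono two tt er) auto
    also have "\<dots> = exp ((ln 2 + t * ln t + 3 * t) * x)"
      by (simp add: exp_add[symmetric] algebra_simps)
    finally have f1: "2 * real t ^ t * (exp 1 * real r) ^ t \<le> exp ((ln 2 + t * ln t + 3 * t) * x)" .
    have pow_d: "a ^ (d * k) \<le> exp (2 * real k * ln a * x)" if "a \<ge> 1" for a :: real and k
    proof -
      have "a ^ (d * k) = exp (real d * (real k * ln a))" using that by (simp add: exp_of_nat_mult mult.commute[of d] flip: power_mult)
      also have "\<dots> \<le> exp (2 * x * (real k * ln a))"
        using d(3) that by (simp add: mult_right_mono)
      finally show ?thesis by (simp add: mult_ac)
    qed
    have f2: "real t ^ (d * (t - 1)) \<le> exp (2 * real (t - 1) * ln t * x)" using t by (intro pow_d) simp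
    have "real L ^ (d * (t - 2)) \<le> (2 * \<beta>) ^ (d * (t - 2))" using L by (intro power_mono) auto
    also have "\<dots> = 2 ^ (d * (t - 2)) * (\<beta> ^ d) ^ (t - 2)" by (simp add: power_mult_distrib power_mult)
    also have "\<dots> = 2 ^ (d * (t - 2)) * B ^ (t - 2) * (\<alpha> ^ (t - 2)) ^ r"
      by (simp add: \<beta>d power_mult_distrib mult.commute flip: power_mult)
    \<comment> \<open>The only factor exponential in \<open>r\<close>; everything else goes into the
      error term.\<close>
    also have "(\<alpha> ^ (t - 2)) ^ r = (real t - 1) ^ ((t - 1) * r)"
      by (simp add: \<alpha>_def growth_power[OF t] power_mult)
    also have "2 ^ (d * (t - 2)) * B ^ (t - 2) * (real t - 1) ^ ((t - 1) * r)
      \<le> exp (2 * real (t - 2) * ln 2 * x) * exp (real (t - 2) * ln B * x) * (real t - 1) ^ ((t - 1) * r)"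
      using B x t by (intro mult_right_mono mult_mono pow_d pow_exp) auto
    also have "\<dots> = exp ((2 * real (t - 2) * ln 2 + real (t - 2) * ln B) * x) * (real t - 1) ^ ((t - 1) * r)"
      by (simp add: exp_add[symmetric] algebra_simps)
    finally have f3: "real L ^ (d * (t - 2))
      \<le> exp ((2 * real (t - 2) * ln 2 + real (t - 2) * ln B) * x) * (real t - 1) ^ ((t - 1) * r)" .
    have "2 * real t ^ t * (exp 1 * real r) ^ t * (real d * real L ^ 2) * real t ^ (d * (t - 1)) * real L ^ (d * (t - 2))
      \<le> exp ((ln 2 + t * ln t + 3 * t) * x) * exp ((2 + 2 * c) * x) * exp (2 * real (t - 1) * ln t * x) *
        (exp ((2 * real (t - 2) * ln 2 + real (t - 2) * ln B) * x) * (real t - 1) ^ ((t - 1) * r))"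
      by (intro mult_mono f1 f2 f3 dL) auto
    also have "\<dots> = exp (C * x) * (real t - 1) ^ ((t - 1) * r)"
      by (simp only: mult.assoc[symmetric] exp_add[symmetric] distrib_right[symmetric] C_def)
    finally have *: "2 * real t ^ t * (exp 1 * real r) ^ t * (real d * real L ^ 2) * real t ^ (d * (t - 1))
      * real L ^ (d * (t - 2)) \<le> exp (C * sqrt r) * (real t - 1) ^ ((t - 1) * r)"
      by (simp add: x_def)
    have "\<beta> ^ d \<le> real L ^ d" using L \<beta>1 by (intro power_mono) auto
    also have "\<dots> \<le> real ((t * L) ^ d)" using t by (simp add: power_mult_distrib mult_le_cancel_right1)
    finally have "2 * 2 ^ (t * t) * growth t ^ r \<le> real ((t * L) ^ d)"
      by (simp add: \<beta>d B_def \<alpha>_def)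
    thus ?thesis using d(1) L(1) * by blast
  qed
  ultimately show thesis using that by blast
qed

section \<open>From survivors to matchings\<close>

text \<open>The lower bounds for \<open>F\<close> and \<open>S\<close> are inserted into
  \<open>w\<close>. One factor \<open>L ^ d\<close> of the group order cancels against the size of
  the box containing \<open>S\<close>, which leaves the exponent \<open>t - 2\<close>.\<close>

lemma (in colour_hash) survivors_card_lower:
  assumes "r \<ge> 2" and S_card: "L ^ d \<le> card S * (d * L\<^sup>2)"
    and w: "real (card F) * real (card S) \<le> 2 * real (card (survivors w)) * real (q ^ d) ^ (t - 1)"
  shows "real t ^ (t * r) \<le> 2 * real t ^ t * (exp 1 * real r) ^ t * (real d * real L ^ 2)
      * real t ^ (d * (t - 1)) * real L ^ (d * (t - 2)) * real (card (survivors w))"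
proof -
  obtain n where n: "r = Suc n" "n \<ge> 1" using assms(1) by (cases r) auto
  have "real t ^ (t * n) * fact n ^ t \<le> real (fact (t * n)) * (exp 1 * real n) ^ t"
    using multinomial_lower[OF n(2), of t] by simp
  also have "\<dots> \<le> real (card F * fact n ^ t) * (exp 1 * real n) ^ t"
  proof (rule mult_right_mono)
    show "real (fact (t * n)) \<le> real (card F * fact n ^ t)"
      using card_balanced_colourings_lower[OF n(2), of t, folded n(1)] unfolding of_nat_le_iff F_def .
  qed simp
  finally have "fact n ^ t * real t ^ (t * n) \<le> fact n ^ t * (real (card F) * (exp 1 * real n) ^ t)"
    by (simp add: mult_ac)
  hence "real t ^ (t * n) \<le> real (card F) * (exp 1 * real n) ^ t" by simp
  also have "\<dots> \<le> real (card F) * (exp 1 * real r) ^ t"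
    using n by (intro mult_left_mono power_mono) auto
  \<comment> \<open>Only \<open>n = r - 1\<close> vertices of each colour are free, and passing from
    \<open>n\<close> to \<open>r\<close> costs \<open>t ^ t\<close>.\<close>
  finally have "real t ^ t * real t ^ (t * n) \<le> real t ^ t * (real (card F) * (exp 1 * real r) ^ t)"
    by (intro mult_left_mono) auto
  hence F: "real t ^ (t * r) \<le> real t ^ t * (exp 1 * real r) ^ t * real (card F)"
    by (simp add: n power_add mult_ac)
  have S: "real L ^ d \<le> real (card S) * (real d * real L ^ 2)"
    using S_card by (metis of_nat_le_iff of_nat_mult of_nat_power)
  have "real t ^ (t * r) * real L ^ d \<le>
    (real t ^ t * (exp 1 * real r) ^ t * real (card F)) * (real (card S) * (real d * real L ^ 2))"
    by (intro mult_mono F S) auto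
  also have "\<dots> = real t ^ t * (exp 1 * real r) ^ t * (real d * real L ^ 2) * (real (card F) * real (card S))"
    by (simp add: mult_ac)
  also have "\<dots> \<le> real t ^ t * (exp 1 * real r) ^ t * (real d * real L ^ 2)
    * (2 * real (card (survivors w)) * real (q ^ d) ^ (t - 1))"
    by (intro mult_left_mono w) auto
  also have "real (q ^ d) ^ (t - 1) = real t ^ (d * (t - 1)) * real L ^ (d * (t - 2)) * real L ^ d"
  proof -
    have "t - 1 = Suc (t - 2)" using t by simp
    thus ?thesis by (simp add: q_def power_mult_distrib flip: power_mult power_add)
  qed
  finally have "real L ^ d * real t ^ (t * r) \<le> real L ^ d * (2 * real t ^ t * (exp 1 * real r) ^ t
      * (real d * real L ^ 2) * real t ^ (d * (t - 1)) * real L ^ (d * (t - 2)) * real (card (survivors w)))"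
    by (simp add: mult_ac)
  thus ?thesis using L by simp
qed

text \<open>Each survivor gives the matching of its blocks. Disjoint edges have distinct colours, so
  reindexing by colour brings them into the form of \<open>survivors_not_mixed\<close>, and
  injectivity of \<open>h\<close> identifies the indices.\<close>

lemma (in colour_hash) survivor_matchings:
  shows "\<exists>(E :: nat set set) M. uniform_hypergraph r V E \<and>
     (\<forall>j\<in>{1..card (survivors w)}. is_matching E (M j) \<and> card (M j) = t) \<and>
     (\<forall>(j :: nat \<Rightarrow> nat) (e :: nat \<Rightarrow> nat set).
        (\<forall>i\<in>{1..t}. j i \<in> {1..card (survivors w)} \<and> e i \<in> M (j i)) \<longrightarrow>
        disjoint_family_on e {1..t} \<longrightarrow> (\<forall>i\<in>{1..t}. \<forall>k\<in>{1..t}. j i = j k))"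
proof -
  have "finite (survivors w)" by (simp add: survivors_def selected_def)
  then obtain h where h: "bij_betw h {1..card (survivors w)} (survivors w)"
    using ex_bij_betw_nat_finite_1 by blast
  define M where "M j = block (h j) ` {..<t}" for j
  define E where "E = {e. e \<subseteq> V \<and> card e = r}"
  have hS: "h j \<in> survivors w" if "j \<in> {1..card (survivors w)}" for j
    using h that by (auto simp: bij_betw_def)
  have hF: "h j \<in> F" if "j \<in> {1..card (survivors w)}" for j
    using hS[OF that] by (simp add: survivors_def selected_def)
  have self: "i \<in> block f i" if "f \<in> F" "i < t" for f i
    using F_D(2)[OF that] special_in_V[OF that(2)] by (simp add: block_def)
  have "uniform_hypergraph r V E"
    by (simp add: uniform_hypergraph_def hypergraph_def E_def)
  moreover have "is_matching E (M j) \<and> card (M j) = t" if j: "j \<in> {1..card (survivors w)}" for j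
  proof
    show "is_matching E (M j)"
      using F_D(3)[OF hF[OF j]]
      by (auto simp: is_matching_def M_def E_def disjoint_def block_def)
    have "inj_on (block (h j)) {..<t}"
    proof (rule inj_onI)
      fix a b assume "a \<in> {..<t}" "b \<in> {..<t}" "block (h j) a = block (h j) b"
      hence "a \<in> block (h j) b" using self[OF hF[OF j], of a] by simp
      thus "a = b" using F_D(2)[OF hF[OF j], of a] \<open>a \<in> {..<t}\<close> by (simp add: block_def)
    qed
    thus "card (M j) = t" by (simp add: M_def card_image)
  qed
  moreover have "\<forall>i\<in>{1..t}. \<forall>k\<in>{1..t}. j i = j k"
    if j: "\<forall>i\<in>{1..t}. j i \<in> {1..card (survivors w)} \<and> e i \<in> M (j i)"
      and e: "disjoint_family_on e {1..t}" for j :: "nat \<Rightarrow> nat" and e :: "nat \<Rightarrow> nat set"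
  proof -
    have "\<exists>k. i \<in> {1..t} \<longrightarrow> k < t \<and> e i = block (h (j i)) k" for i
      using j unfolding M_def by blast
    then obtain k where k: "\<And>i. i \<in> {1..t} \<Longrightarrow> k i < t" "\<And>i. i \<in> {1..t} \<Longrightarrow> e i = block (h (j i)) (k i)"
      by metis
    \<comment> \<open>Two blocks of the same colour \<open>k a\<close> both contain the vertex
      \<open>k a\<close>, so they are not disjoint.\<close>
    have "inj_on k {1..t}"
    proof (rule inj_onI, rule ccontr)
      fix a b assume ab: "a \<in> {1..t}" "b \<in> {1..t}" "k a = k b" "a \<noteq> b"
      have "k a \<in> e a" using k[OF ab(1)] self hF j ab(1) by simp
      moreover have "k a \<in> e b" using k[OF ab(2)] self hF j ab(2,3) by simp
      moreover have "e a \<inter> e b = {}" using e ab by (simp add: disjoint_family_on_def)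
      ultimately show False using ab(3) by auto
    qed
    moreover from this have "k ` {1..t} = {..<t}"
      using k(1) by (intro card_subset_eq) (auto simp: card_image)
    ultimately have kb: "bij_betw k {1..t} {..<t}" by (simp add: bij_betw_def)
    define l where "l = inv_into {1..t} k"
    have l: "l m \<in> {1..t}" "k (l m) = m" if "m < t" for m
    proof -
      have "m \<in> k ` {1..t}" using kb that by (simp add: bij_betw_def)
      thus "l m \<in> {1..t}" "k (l m) = m" unfolding l_def by (rule inv_into_into, rule f_inv_into_f)
    qed
    have lk: "l (k i) = i" if "i \<in> {1..t}" for i
      using kb that by (simp add: l_def bij_betw_def)
    have eq: "h (j (l a)) = h (j (l b))" if "a < t" "b < t" for a b
    proof (rule survivors_not_mixed[where h = "\<lambda>m. h (j (l m))" and w = w])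
      show "h (j (l m)) \<in> survivors w" if "m < t" for m using hS j l[OF that] by blast
      show "block (h (j (l m))) m \<inter> block (h (j (l m'))) m' = {}" if "m < t" "m' < t" "m \<noteq> m'" for m m'
      proof -
        have "l m \<noteq> l m'" using l that by metis
        hence "e (l m) \<inter> e (l m') = {}" using e l that by (auto simp: disjoint_family_on_def)
        thus ?thesis using k(2) l that by simp
      qed
    qed (use that in auto)
    show ?thesis
    proof (intro ballI)
      fix a b assume ab: "a \<in> {1..t}" "b \<in> {1..t}"
      have "h (j a) = h (j b)" using eq[OF k(1)[OF ab(1)] k(1)[OF ab(2)]] lk ab by simp
      thus "j a = j b" using h j ab by (auto simp: bij_betw_def dest: inj_onD)
    qed
  qed
  ultimately show ?thesis by blast
qed

theorem theorem4p2:
  fixes t :: nat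
  assumes "t \<ge> 2"
  shows "\<exists>D::real. D \<ge> 0 \<and>
    (\<forall>r::nat. r \<ge> 2 \<longrightarrow>
      (\<exists>(V :: nat set) (E :: nat set set) (N :: nat) (M :: nat \<Rightarrow> nat set set).
         uniform_hypergraph r V E \<and> card V = t * r \<and>
         (\<forall>j\<in>{1..N}. is_matching E (M j) \<and> card (M j) = t) \<and>
         real N \<ge> (real t ^ t / (real t - 1) ^ (t - 1)) powr (real r - D * sqrt (real r)) \<and>
         (\<forall>(j :: nat \<Rightarrow> nat) (e :: nat \<Rightarrow> nat set).
            (\<forall>i\<in>{1..t}. j i \<in> {1..N} \<and> e i \<in> M (j i)) \<longrightarrow>
            disjoint_family_on e {1..t} \<longrightarrow>
            (\<forall>i\<in>{1..t}. \<forall>k\<in>{1..t}. j i = j k))))"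
proof -
  define \<gamma> where "\<gamma> = real t ^ t / (real t - 1) ^ (t - 1)"
  obtain C where C: "C \<ge> 0" and par: "\<And>r :: nat. r \<ge> 1 \<Longrightarrow> \<exists>d L :: nat. d \<ge> 1 \<and> L \<ge> 1 \<and>
    2 * 2 ^ (t * t) * growth t ^ r \<le> real ((t * L) ^ d) \<and>
    2 * real t ^ t * (exp 1 * real r) ^ t * (real d * real L ^ 2) * real t ^ (d * (t - 1)) * real L ^ (d * (t - 2))
      \<le> exp (C * sqrt r) * (real t - 1) ^ ((t - 1) * r)"
    using exists_parameters[OF assms] by blast
  have "(real t - 1) ^ (t - 1) \<le> real t ^ (t - 1)" using assms by (intro power_mono) auto
  also have "\<dots> < real t ^ t" using assms by (intro power_strict_increasing) auto
  finally have "\<gamma> > 1" using assms by (simp add: \<gamma>_def)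
  \<comment> \<open>Chosen so that \<open>exp (C * sqrt r)\<close> equals \<gamma> to the power
    \<open>D * sqrt r\<close>.\<close>
  define D where "D = C / ln \<gamma>"
  have "D \<ge> 0" using C \<open>\<gamma> > 1\<close> by (simp add: D_def)
  moreover have "\<exists>(V :: nat set) (E :: nat set set) (N :: nat) (M :: nat \<Rightarrow> nat set set).
         uniform_hypergraph r V E \<and> card V = t * r \<and>
         (\<forall>j\<in>{1..N}. is_matching E (M j) \<and> card (M j) = t) \<and>
         real N \<ge> \<gamma> powr (real r - D * sqrt (real r)) \<and>
         (\<forall>(j :: nat \<Rightarrow> nat) (e :: nat \<Rightarrow> nat set).
            (\<forall>i\<in>{1..t}. j i \<in> {1..N} \<and> e i \<in> M (j i)) \<longrightarrow>
            disjoint_family_on e {1..t} \<longrightarrow>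
            (\<forall>i\<in>{1..t}. \<forall>k\<in>{1..t}. j i = j k))" if r2: "r \<ge> 2" for r :: nat
  proof -
    obtain d L where dL: "d \<ge> 1" "L \<ge> 1"
      and Q: "2 * 2 ^ (t * t) * growth t ^ r \<le> real ((t * L) ^ d)"
      and loss: "2 * real t ^ t * (exp 1 * real r) ^ t * (real d * real L ^ 2) * real t ^ (d * (t - 1))
        * real L ^ (d * (t - 2)) \<le> exp (C * sqrt r) * (real t - 1) ^ ((t - 1) * r)"
      using par[of r] r2 by auto
    obtain S \<rho> where S: "S \<subseteq> {..<d} \<rightarrow>\<^sub>E {0..<int L}" "\<And>s. s \<in> S \<Longrightarrow> (\<Sum>c<d. (s c)\<^sup>2) = \<rho>"
      and S_card: "L ^ d \<le> card S * (d * L\<^sup>2)"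
      using exists_large_sphere[OF dL] by blast
    interpret colour_hash t r d L S \<rho>
      using assms r2 dL S by unfold_locales auto
    obtain w where w: "real (card F) * real (card S) \<le> 2 * real (card (survivors w)) * real (q ^ d) ^ (t - 1)"
      using exists_many_survivors Q by (auto simp: q_def)
    define N where "N = card (survivors w)"
    have "real t ^ (t * r) \<le> exp (C * sqrt r) * (real t - 1) ^ ((t - 1) * r) * real N"
      using survivors_card_lower[OF r2 S_card w] mult_right_mono[OF loss, of "real N"] unfolding N_def by linarith
    hence "\<gamma> ^ r \<le> exp (C * sqrt r) * real N"
      using assms by (simp add: \<gamma>_def power_divide divide_le_eq mult_ac flip: power_mult)
    moreover have "\<gamma> powr (real r - D * sqrt r) = \<gamma> ^ r / exp (C * sqrt r)"
      using \<open>\<gamma> > 1\<close> by (simp add: powr_diff powr_realpow) (simp add: powr_def D_def)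
    ultimately have "\<gamma> powr (real r - D * sqrt r) \<le> real N" by (simp add: divide_le_eq mult.commute)
    thus ?thesis using survivor_matchings[of w] cardV unfolding N_def by blast
  qed
  ultimately show ?thesis unfolding \<gamma>_def by blast
qed

end
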